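(* There are absolute constants $C,c>0$ such that the following holds. Let $n,t\ge 2$ be integers and $p\in[1/t,1]$, with $n\ge C t^2$. Let $\mathcal{ALG}$ be an $\ell$-pass streaming algorithm with $s$ bits of memory which distinguishes between $\mathrm{Uniform}$ and $\mathrm{Planted}_p$ with error at most $1/3$. Then $$\ell\, p^2\, s\, t\,\log(t)\ \ge\ c .$$
   Context: Streams are sequences $X=(X_1,\ldots,X_t)\in[n]^t$. $\mathrm{Uniform}$ is the uniform distribution on $[n]^t$. $\mathrm{Planted}_p$ (the planted needle distribution with needle probability $p$) is sampled as follows: choose a uniform "needle" $x\in[n]$; then independently for each position $i\in[t]$, with probability $p$ set $X_i=x$, and otherwise sample $X_i\in[n]$ uniformly. An $\ell$-pass streaming algorithm with $s$ bits of memory reads the stream $X_1,\ldots,X_t$ in order $\ell$ times, keeping only an $s$-bit memory state between reading consecutive elements, and outputs a bit at the end. It distinguishes between distributions $D_0,D_1$ with error $\delta$ if, when the stream is drawn from $D_b$ for a uniformly random $b\in\{0,1\}$, its output equals $b$ with probability at least $1-\delta$. Logarithms are base 2. *)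

theory Defs
  imports "HOL-Probability.Probability"
begin

definition uniform_stream :: "nat \<Rightarrow> nat \<Rightarrow> (nat \<Rightarrow> nat) pmf" where
  "uniform_stream n t = Pi_pmf {0..<t} 0 (\<lambda>_. pmf_of_set {0..<n})"

definition planted_stream :: "nat \<Rightarrow> nat \<Rightarrow> real \<Rightarrow> (nat \<Rightarrow> nat) pmf" where
  "planted_stream n t p =
     bind_pmf (pmf_of_set {0..<n}) (\<lambda>x.
       Pi_pmf {0..<t} 0 (\<lambda>_. bind_pmf (bernoulli_pmf p)
          (\<lambda>b. if b then return_pmf x else pmf_of_set {0..<n})))"

definition stream_run ::
  "(nat \<Rightarrow> nat \<Rightarrow> nat \<Rightarrow> nat \<Rightarrow> nat) \<Rightarrow> nat \<Rightarrow> nat \<Rightarrow> nat \<Rightarrow> (nat \<Rightarrow> nat) \<Rightarrow> nat" where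
  "stream_run step init l t X =
     fold (\<lambda>j st. fold (\<lambda>i st'. step j i st' (X i)) [0..<t] st) [0..<l] init"

text \<open>Randomized algorithm: a random seed r drawn from R (public randomness, arbitrary
  discrete distribution) selects transition function step r, initial state init r and
  output function out r.  Success probability when b is a uniform bit, the stream is drawn
  from Planted_p if b = True and from Uniform if b = False, and the algorithm must output b.\<close>

definition success_prob ::
  "nat pmf \<Rightarrow> (nat \<Rightarrow> nat \<Rightarrow> nat \<Rightarrow> nat \<Rightarrow> nat \<Rightarrow> nat) \<Rightarrow> (nat \<Rightarrow> nat)
   \<Rightarrow> (nat \<Rightarrow> nat \<Rightarrow> bool) \<Rightarrow> nat \<Rightarrow> nat \<Rightarrow> nat \<Rightarrow> real \<Rightarrow> real" where
  "success_prob R step init out l n t p =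
     pmf (do { b \<leftarrow> bernoulli_pmf (1/2);
               r \<leftarrow> R;
               X \<leftarrow> (if b then planted_stream n t p else uniform_stream n t);
               return_pmf (out r (stream_run (step r) (init r) l t X) = b) }) True"

definition streaming_alg_mem ::
  "nat \<Rightarrow> (nat \<Rightarrow> nat \<Rightarrow> nat \<Rightarrow> nat \<Rightarrow> nat \<Rightarrow> nat) \<Rightarrow> (nat \<Rightarrow> nat) \<Rightarrow> bool" where
  "streaming_alg_mem s step init \<longleftrightarrow>
     (\<forall>r. init r < 2 ^ s) \<and> (\<forall>r j i st a. step r j i st a < 2 ^ s)"

end

theory Submission
  imports Defs
begin

text \<open>Fix the seed. Planting a needle \<open>x\<close> means overwriting a uniform stream by \<open>x\<close> on a random set
  \<open>S\<close> of positions. Around each \<open>u \<in> S\<close> take the largest dyadic block containing no other element of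
  \<open>S\<close>; these blocks are disjoint. Publish all memory states except those strictly inside the blocks.
  For this transcript the blocks behave like players of a number-in-hand protocol, so cut-and-paste
  for the Hellinger distance bounds the loss caused by \<open>S\<close> by a constant times the sum of the losses
  caused by the single positions. Within a block the run exchanges only \<open>l * s\<close> bits with the rest of
  the stream, so by subadditivity of entropy the losses of its positions add up to at most \<open>l * s\<close>
  on average over \<open>x\<close>. A position lies in \<open>S\<close> and has a block of length \<open>2 ^ k\<close> with probability at most
  \<open>2 ^ (k + 1) * p\<^sup>2\<close>, and there are about \<open>t / 2 ^ k\<close> blocks of that length, so every dyadic scale
  contributes \<open>O(l * s * p\<^sup>2 * t)\<close>; there are \<open>O(log t)\<close> scales.\<close>

subsection \<open>Bhattacharyya coefficients\<close>

text \<open>Bhattacharyya coefficient of the laws of \<open>F X\<close> and \<open>G X\<close> for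
  \<open>X\<close> uniform on \<open>\<Omega>\<close>, in counting form; \<open>1 - bhatt\<close> is
  the squared Hellinger distance and serves as the loss throughout.\<close>

definition bhatt :: "'a set \<Rightarrow> ('a \<Rightarrow> 'b) \<Rightarrow> ('a \<Rightarrow> 'b) \<Rightarrow> real" where
  "bhatt \<Omega> F G = (\<Sum>\<tau>\<in>F ` \<Omega> \<union> G ` \<Omega>.
     sqrt (real (card {X\<in>\<Omega>. F X = \<tau>}) * real (card {X\<in>\<Omega>. G X = \<tau>}))) / real (card \<Omega>)"

lemma bhatt_superset:
  assumes "finite T" "F ` \<Omega> \<union> G ` \<Omega> \<subseteq> T"
  shows "bhatt \<Omega> F G = (\<Sum>\<tau>\<in>T.
     sqrt (real (card {X\<in>\<Omega>. F X = \<tau>}) * real (card {X\<in>\<Omega>. G X = \<tau>}))) / real (card \<Omega>)"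
proof -
  have "sqrt (real (card {X\<in>\<Omega>. F X = \<tau>}) * real (card {X\<in>\<Omega>. G X = \<tau>})) = 0"
    if "\<tau> \<in> T - (F ` \<Omega> \<union> G ` \<Omega>)" for \<tau>
  proof -
    have "{X\<in>\<Omega>. F X = \<tau>} = {}" using that by auto
    then show ?thesis by (simp only: card.empty of_nat_0 mult_zero_left real_sqrt_zero)
  qed
  then show ?thesis
    unfolding bhatt_def using assms
    by (intro arg_cong2[where f="(/)"] sum.mono_neutral_left refl) blast+
qed

lemma sum_card_fibres:
  assumes "finite \<Omega>" "finite T" "F ` \<Omega> \<subseteq> T"
  shows "(\<Sum>\<sigma>\<in>{\<sigma>\<in>T. Q \<sigma>}. real (card {X\<in>\<Omega>. F X = \<sigma>})) = real (card {X\<in>\<Omega>. Q (F X)})"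
proof -
  have "card {X\<in>\<Omega>. Q (F X)} = card (\<Union>\<sigma>\<in>{\<sigma>\<in>T. Q \<sigma>}. {X\<in>\<Omega>. F X = \<sigma>})"
    using assms by (intro arg_cong[where f=card]) auto
  also have "\<dots> = (\<Sum>\<sigma>\<in>{\<sigma>\<in>T. Q \<sigma>}. card {X\<in>\<Omega>. F X = \<sigma>})"
    using assms by (intro card_UN_disjoint) auto
  finally show ?thesis by simp
qed

text \<open>Data processing: applying \<open>g\<close> merges outcomes, and Cauchy-Schwarz on each
  fibre of \<open>g\<close> shows that merging can only increase the coefficient.\<close>

lemma bhatt_comp_ge:
  assumes fin: "finite \<Omega>"
  shows "bhatt \<Omega> F G \<le> bhatt \<Omega> (\<lambda>X. g (F X)) (\<lambda>X. g (G X))"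
proof -
  define T where "T = F ` \<Omega> \<union> G ` \<Omega>"
  define a where "a = (\<lambda>\<sigma>. real (card {X\<in>\<Omega>. F X = \<sigma>}))"
  define b where "b = (\<lambda>\<sigma>. real (card {X\<in>\<Omega>. G X = \<sigma>}))"
  have finT: "finite T" using fin by (simp add: T_def)
  have nn: "a \<sigma> \<ge> 0" "b \<sigma> \<ge> 0" for \<sigma> by (auto simp: a_def b_def)
  have "(\<Sum>\<sigma>\<in>T. sqrt (a \<sigma> * b \<sigma>)) = (\<Sum>\<tau>\<in>g ` T. \<Sum>\<sigma>\<in>{\<sigma>\<in>T. g \<sigma> = \<tau>}. sqrt (a \<sigma> * b \<sigma>))"
    by (rule sum.image_gen[OF finT])
  also have "\<dots> \<le> (\<Sum>\<tau>\<in>g ` T. sqrt (real (card {X\<in>\<Omega>. g (F X) = \<tau>}) * real (card {X\<in>\<Omega>. g (G X) = \<tau>})))"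
  proof (rule sum_mono)
    fix \<tau>
    have "(\<Sum>\<sigma>\<in>{\<sigma>\<in>T. g \<sigma> = \<tau>}. sqrt (a \<sigma>) * sqrt (b \<sigma>))\<^sup>2
      \<le> (\<Sum>\<sigma>\<in>{\<sigma>\<in>T. g \<sigma> = \<tau>}. (sqrt (a \<sigma>))\<^sup>2) * (\<Sum>\<sigma>\<in>{\<sigma>\<in>T. g \<sigma> = \<tau>}. (sqrt (b \<sigma>))\<^sup>2)"
      by (rule Cauchy_Schwarz_ineq_sum)
    also have "\<dots> = (\<Sum>\<sigma>\<in>{\<sigma>\<in>T. g \<sigma> = \<tau>}. a \<sigma>) * (\<Sum>\<sigma>\<in>{\<sigma>\<in>T. g \<sigma> = \<tau>}. b \<sigma>)"
      using nn by simp
    also have "\<dots> = real (card {X\<in>\<Omega>. g (F X) = \<tau>}) * real (card {X\<in>\<Omega>. g (G X) = \<tau>})"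
      unfolding a_def b_def
      by (subst (1 2) sum_card_fibres[OF fin finT]) (auto simp: T_def)
    finally show "(\<Sum>\<sigma>\<in>{\<sigma>\<in>T. g \<sigma> = \<tau>}. sqrt (a \<sigma> * b \<sigma>)) \<le>
        sqrt (real (card {X\<in>\<Omega>. g (F X) = \<tau>}) * real (card {X\<in>\<Omega>. g (G X) = \<tau>}))"
      by (intro real_le_rsqrt) (simp add: real_sqrt_mult)
  qed
  finally have "(\<Sum>\<sigma>\<in>T. sqrt (a \<sigma> * b \<sigma>)) / real (card \<Omega>) \<le>
     (\<Sum>\<tau>\<in>g ` T. sqrt (real (card {X\<in>\<Omega>. g (F X) = \<tau>}) * real (card {X\<in>\<Omega>. g (G X) = \<tau>}))) / real (card \<Omega>)"
    by (rule divide_right_mono) simp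
  also have "\<dots> = bhatt \<Omega> (\<lambda>X. g (F X)) (\<lambda>X. g (G X))"
    by (rule bhatt_superset[symmetric]) (use finT in \<open>auto simp: T_def\<close>)
  finally show ?thesis unfolding bhatt_def T_def a_def b_def .
qed

text \<open>Data processing when \<open>H\<close> is only implicitly a function of \<open>F\<close>.
  Since \<open>\<phi>\<close> stays in \<open>\<Omega>\<close>, the same function also turns
  \<open>F (\<phi> X)\<close> into \<open>H (\<phi> X)\<close>.\<close>

lemma bhatt_refine:
  assumes fin: "finite \<Omega>"
    and det: "\<And>X Y. X \<in> \<Omega> \<Longrightarrow> Y \<in> \<Omega> \<Longrightarrow> F X = F Y \<Longrightarrow> H X = H Y"
    and \<phi>: "\<And>X. X \<in> \<Omega> \<Longrightarrow> \<phi> X \<in> \<Omega>"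
  shows "bhatt \<Omega> F (\<lambda>X. F (\<phi> X)) \<le> bhatt \<Omega> H (\<lambda>X. H (\<phi> X))"
proof -
  define g where "g = (\<lambda>\<tau>. H (inv_into \<Omega> F \<tau>))"
  have g: "g (F X) = H X" if "X \<in> \<Omega>" for X
    unfolding g_def using that by (intro det) (auto simp: inv_into_into f_inv_into_f)
  have "bhatt \<Omega> F (\<lambda>X. F (\<phi> X)) \<le> bhatt \<Omega> (\<lambda>X. g (F X)) (\<lambda>X. g (F (\<phi> X)))"
    by (rule bhatt_comp_ge[OF fin])
  also have "\<dots> = bhatt \<Omega> H (\<lambda>X. H (\<phi> X))"
  proof -
    have 1: "{X\<in>\<Omega>. g (F X) = \<tau>} = {X\<in>\<Omega>. H X = \<tau>}"
      "{X\<in>\<Omega>. g (F (\<phi> X)) = \<tau>} = {X\<in>\<Omega>. H (\<phi> X) = \<tau>}" for \<tau>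
      using g \<phi> by auto
    have 2: "(\<lambda>X. g (F X)) ` \<Omega> = H ` \<Omega>" "(\<lambda>X. g (F (\<phi> X))) ` \<Omega> = (\<lambda>X. H (\<phi> X)) ` \<Omega>"
      using g \<phi> by (auto simp: image_iff)
    show ?thesis unfolding bhatt_def 1 2 ..
  qed
  finally show ?thesis .
qed

text \<open>Hellinger distance controls the gap of a yes/no test: write \<open>b - a\<close> as
  \<open>(sqrt b - sqrt a) * (sqrt b + sqrt a)\<close>. The square of the first factor is at most
  \<open>2 * (1 - bhatt \<Omega> F G)\<close>, that of the second at most 4.\<close>

lemma acceptance_gap_le_bhatt:
  fixes F G :: "'a \<Rightarrow> bool"
  assumes fin: "finite \<Omega>" and ne: "\<Omega> \<noteq> {}"
  shows "(real (card {X\<in>\<Omega>. G X}) / real (card \<Omega>) - real (card {X\<in>\<Omega>. F X}) / real (card \<Omega>))\<^sup>2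
           \<le> 8 * (1 - bhatt \<Omega> F G)"
proof -
  define N where "N = real (card \<Omega>)"
  have N: "N > 0" using fin ne by (simp add: N_def card_gt_0_iff)
  define a where "a = real (card {X\<in>\<Omega>. F X}) / N"
  define b where "b = real (card {X\<in>\<Omega>. G X}) / N"
  define a' where "a' = real (card {X\<in>\<Omega>. \<not> F X}) / N"
  define b' where "b' = real (card {X\<in>\<Omega>. \<not> G X}) / N"
  have tot: "real (card {X\<in>\<Omega>. Q X}) + real (card {X\<in>\<Omega>. \<not> Q X}) = N" for Q
  proof -
    have "card \<Omega> = card ({X\<in>\<Omega>. Q X} \<union> {X\<in>\<Omega>. \<not> Q X})" by (intro arg_cong[where f=card]) auto
    also have "\<dots> = card {X\<in>\<Omega>. Q X} + card {X\<in>\<Omega>. \<not> Q X}"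
      using fin by (intro card_Un_disjoint) auto
    finally show ?thesis by (simp add: N_def)
  qed
  have a: "a \<ge> 0" "a' \<ge> 0" "a + a' = 1" and b: "b \<ge> 0" "b' \<ge> 0" "b + b' = 1"
    using N tot[of F] tot[of G] by (simp_all add: a_def a'_def b_def b'_def flip: add_divide_distrib)
  have "bhatt \<Omega> F G = (\<Sum>\<tau>\<in>UNIV.
     sqrt (real (card {X\<in>\<Omega>. F X = \<tau>}) * real (card {X\<in>\<Omega>. G X = \<tau>}))) / N"
    unfolding N_def by (rule bhatt_superset) auto
  also have "\<dots> = sqrt (a * b) + sqrt (a' * b')"
    using N by (simp add: UNIV_bool a_def b_def a'_def b'_def real_sqrt_mult real_sqrt_divide add_divide_distrib)
  finally have bh: "bhatt \<Omega> F G = sqrt a * sqrt b + sqrt a' * sqrt b'" by (simp add: real_sqrt_mult)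
  have sq: "(sqrt a)\<^sup>2 = a" "(sqrt b)\<^sup>2 = b" "(sqrt a')\<^sup>2 = a'" "(sqrt b')\<^sup>2 = b'"
    using a b by auto
  have "(sqrt b - sqrt a)\<^sup>2 + (sqrt b' - sqrt a')\<^sup>2 = 2 * (1 - bhatt \<Omega> F G)"
    unfolding bh power2_diff using sq a(3) b(3) by (simp add: algebra_simps)
  then have 1: "(sqrt b - sqrt a)\<^sup>2 \<le> 2 * (1 - bhatt \<Omega> F G)"
    using zero_le_power2[of "sqrt b' - sqrt a'"] by linarith
  have "sqrt a \<le> 1" "sqrt b \<le> 1" using a b by auto
  then have 2: "(sqrt b + sqrt a)\<^sup>2 \<le> 2\<^sup>2"
    using a b by (intro power_mono add_nonneg_nonneg) (linarith | simp)+
  have "b - a = (sqrt b - sqrt a) * (sqrt b + sqrt a)"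
    using sq by (simp add: algebra_simps power2_eq_square)
  then have "(b - a)\<^sup>2 = (sqrt b - sqrt a)\<^sup>2 * (sqrt b + sqrt a)\<^sup>2"
    by (simp add: power_mult_distrib)
  also have "\<dots> \<le> (sqrt b - sqrt a)\<^sup>2 * 2\<^sup>2" by (intro mult_left_mono 2) auto
  also have "\<dots> \<le> 8 * (1 - bhatt \<Omega> F G)" using 1 by simp
  finally show ?thesis by (simp add: a_def b_def N_def)
qed

lemma bhatt_le_1:
  assumes fin: "finite \<Omega>"
  shows "bhatt \<Omega> F G \<le> 1"
proof (cases "\<Omega> = {}")
  case False
  define N where "N = real (card \<Omega>)"
  define T where "T = F ` \<Omega> \<union> G ` \<Omega>"
  have N: "N > 0" using fin False by (simp add: N_def card_gt_0_iff)
  have sub: "finite T" "F ` \<Omega> \<subseteq> T" "G ` \<Omega> \<subseteq> T" using fin by (auto simp: T_def)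
  have tot: "(\<Sum>\<tau>\<in>T. real (card {X\<in>\<Omega>. F X = \<tau>})) = N" "(\<Sum>\<tau>\<in>T. real (card {X\<in>\<Omega>. G X = \<tau>})) = N"
    using sum_card_fibres[of \<Omega> T F "\<lambda>_. True"] sum_card_fibres[of \<Omega> T G "\<lambda>_. True"] fin sub
    by (simp_all add: N_def)
  have "(\<Sum>\<tau>\<in>T. sqrt (real (card {X\<in>\<Omega>. F X = \<tau>}) * real (card {X\<in>\<Omega>. G X = \<tau>})))
      \<le> (\<Sum>\<tau>\<in>T. (real (card {X\<in>\<Omega>. F X = \<tau>}) + real (card {X\<in>\<Omega>. G X = \<tau>})) / 2)"
    by (intro sum_mono arith_geo_mean_sqrt) auto
  also have "\<dots> = N" using tot by (simp add: sum.distrib flip: sum_divide_distrib)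
  finally show ?thesis using N unfolding bhatt_def T_def N_def by simp
qed (simp add: bhatt_def)

subsection \<open>Merging parties\<close>

lemma sum_sqrt_mult_le_1:
  fixes a b :: "'b \<Rightarrow> real"
  assumes "\<And>\<tau>. a \<tau> \<ge> 0" "\<And>\<tau>. b \<tau> \<ge> 0" "(\<Sum>\<tau>\<in>T. a \<tau>) = 1" "(\<Sum>\<tau>\<in>T. b \<tau>) = 1"
  shows "(\<Sum>\<tau>\<in>T. sqrt (a \<tau> * b \<tau>)) \<le> 1"
proof -
  have "(\<Sum>\<tau>\<in>T. sqrt (a \<tau> * b \<tau>)) \<le> (\<Sum>\<tau>\<in>T. (a \<tau> + b \<tau>) / 2)"
    using assms by (intro sum_mono arith_geo_mean_sqrt) auto
  also have "\<dots> = ((\<Sum>\<tau>\<in>T. a \<tau>) + (\<Sum>\<tau>\<in>T. b \<tau>)) / 2"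
    by (simp only: sum_divide_distrib[symmetric] sum.distrib)
  finally show ?thesis using assms by simp
qed

text \<open>The vectors \<open>sqrt (P A _)\<close> have unit length and, by the product property \<open>paste\<close>, pairwise
  inner products \<open>1 - eps (A \<union> B)\<close>, so this is
  \<open>0 \<le> \<parallel>(\<Sum>A\<in>F. sqrt (P A)) - card F * sqrt (P {})\<parallel>\<^sup>2\<close>.\<close>

lemma merge_pairs:
  fixes P :: "'a set \<Rightarrow> 'b \<Rightarrow> real"
  assumes T: "finite T"
    and nn: "\<And>A \<tau>. P A \<tau> \<ge> 0"
    and one: "\<And>A. A \<subseteq> S \<Longrightarrow> (\<Sum>\<tau>\<in>T. P A \<tau>) = 1"
    and paste: "\<And>A B \<tau>. A \<subseteq> S \<Longrightarrow> B \<subseteq> S \<Longrightarrow> A \<inter> B = {} \<Longrightarrow> P {} \<tau> * P (A \<union> B) \<tau> = P A \<tau> * P B \<tau>"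
    and eps: "\<And>A. eps A = 1 - (\<Sum>\<tau>\<in>T. sqrt (P {} \<tau> * P A \<tau>))"
    and F: "finite F" "\<And>A. A \<in> F \<Longrightarrow> A \<subseteq> S" "pairwise disjnt F"
  shows "(\<Sum>A\<in>F. \<Sum>B\<in>F - {A}. eps (A \<union> B)) \<le> 2 * real (card F) * (\<Sum>A\<in>F. eps A)"
proof -
  define v where "v = (\<lambda>A \<tau>. sqrt (P A \<tau>))"
  define r where "r = real (card F)"
  define V where "V = (\<lambda>\<tau>. \<Sum>A\<in>F. v A \<tau>)"
  have self: "(\<Sum>\<tau>\<in>T. v A \<tau> * v A \<tau>) = 1" if "A \<subseteq> S" for A
    using one[OF that] nn by (simp add: v_def)
  have "(\<Sum>A\<in>F. \<Sum>B\<in>F - {A}. eps (A \<union> B)) = (\<Sum>A\<in>F. \<Sum>B\<in>F - {A}. 1 - (\<Sum>\<tau>\<in>T. v A \<tau> * v B \<tau>))"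
  proof (intro sum.cong refl)
    fix A B assume "A \<in> F" "B \<in> F - {A}"
    then have "disjnt A B" using F(3) by (auto dest: pairwiseD)
    then have "A \<inter> B = {}" "A \<subseteq> S" "B \<subseteq> S"
      using F(2) \<open>A \<in> F\<close> \<open>B \<in> F - {A}\<close> by (auto simp: disjnt_def)
    then show "eps (A \<union> B) = 1 - (\<Sum>\<tau>\<in>T. v A \<tau> * v B \<tau>)"
      unfolding eps by (simp add: paste v_def real_sqrt_mult)
  qed
  \<comment> \<open>The diagonal terms may be added because each vector has unit length, so they
    vanish.\<close>
  also have "\<dots> = (\<Sum>A\<in>F. \<Sum>B\<in>F. 1 - (\<Sum>\<tau>\<in>T. v A \<tau> * v B \<tau>))"
  proof (rule sum.cong[OF refl])
    fix A assume A: "A \<in> F"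
    show "(\<Sum>B\<in>F - {A}. 1 - (\<Sum>\<tau>\<in>T. v A \<tau> * v B \<tau>)) = (\<Sum>B\<in>F. 1 - (\<Sum>\<tau>\<in>T. v A \<tau> * v B \<tau>))"
      using self[OF F(2)[OF A]]
      by (simp add: sum.remove[OF F(1) A, of "\<lambda>B. 1 - (\<Sum>\<tau>\<in>T. v A \<tau> * v B \<tau>)"])
  qed
  also have "\<dots> = r * r - (\<Sum>A\<in>F. \<Sum>B\<in>F. \<Sum>\<tau>\<in>T. v A \<tau> * v B \<tau>)"
    by (simp add: sum_subtractf r_def)
  also have "(\<Sum>A\<in>F. \<Sum>B\<in>F. \<Sum>\<tau>\<in>T. v A \<tau> * v B \<tau>) = (\<Sum>A\<in>F. \<Sum>\<tau>\<in>T. v A \<tau> * V \<tau>)"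
    by (simp add: V_def sum_distrib_left sum.swap[of _ T F])
  also have "\<dots> = (\<Sum>\<tau>\<in>T. V \<tau> * V \<tau>)"
    by (subst sum.swap) (simp add: V_def sum_distrib_right)
  finally have L: "(\<Sum>A\<in>F. \<Sum>B\<in>F - {A}. eps (A \<union> B)) = r * r - (\<Sum>\<tau>\<in>T. V \<tau> * V \<tau>)" .
  have "(\<Sum>A\<in>F. eps A) = r - (\<Sum>A\<in>F. \<Sum>\<tau>\<in>T. v {} \<tau> * v A \<tau>)"
    unfolding eps by (simp add: sum_subtractf r_def v_def real_sqrt_mult)
  also have "(\<Sum>A\<in>F. \<Sum>\<tau>\<in>T. v {} \<tau> * v A \<tau>) = (\<Sum>\<tau>\<in>T. v {} \<tau> * V \<tau>)"
    by (subst sum.swap) (simp add: V_def sum_distrib_left)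
  finally have R: "(\<Sum>A\<in>F. eps A) = r - (\<Sum>\<tau>\<in>T. v {} \<tau> * V \<tau>)" .
  have "0 \<le> (\<Sum>\<tau>\<in>T. (V \<tau> - r * v {} \<tau>)\<^sup>2)" by (intro sum_nonneg) auto
  also have "\<dots> = (\<Sum>\<tau>\<in>T. V \<tau> * V \<tau> - 2 * r * (v {} \<tau> * V \<tau>) + r * r * (v {} \<tau> * v {} \<tau>))"
    by (intro sum.cong refl) (simp add: power2_eq_square algebra_simps)
  also have "\<dots> = (\<Sum>\<tau>\<in>T. V \<tau> * V \<tau>) - 2 * r * (\<Sum>\<tau>\<in>T. v {} \<tau> * V \<tau>) + r * r"
    using self[of "{}"] by (simp add: sum.distrib sum_subtractf flip: sum_distrib_left)
  finally show ?thesis unfolding L R using r_def by (simp add: algebra_simps)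
qed

text \<open>Induction on the number of parts. With \<open>R\<close> parts some pair can be merged so
  that the total loss grows by a factor at most \<open>1 + 2 / (R * (R - 1))\<close>, hence at most
  \<open>exp (2 / (R - 1) - 2 / R)\<close>. These exponents telescope, which keeps the constant
  bounded whatever the number of parts.\<close>

lemma eps_Union_le:
  fixes P :: "'a set \<Rightarrow> 'b \<Rightarrow> real"
  assumes T: "finite T"
    and nn: "\<And>A \<tau>. P A \<tau> \<ge> 0"
    and one: "\<And>A. A \<subseteq> S \<Longrightarrow> (\<Sum>\<tau>\<in>T. P A \<tau>) = 1"
    and paste: "\<And>A B \<tau>. A \<subseteq> S \<Longrightarrow> B \<subseteq> S \<Longrightarrow> A \<inter> B = {} \<Longrightarrow> P {} \<tau> * P (A \<union> B) \<tau> = P A \<tau> * P B \<tau>"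
    and eps: "\<And>A. eps A = 1 - (\<Sum>\<tau>\<in>T. sqrt (P {} \<tau> * P A \<tau>))"
    and F: "finite F" "\<And>A. A \<in> F \<Longrightarrow> A \<subseteq> S \<and> A \<noteq> {}" "pairwise disjnt F" "card F = Suc r"
  shows "eps (\<Union>F) \<le> exp (2 - 2 / real (Suc r)) * (\<Sum>A\<in>F. eps A)"
  using F
proof (induction r arbitrary: F)
  case 0
  then obtain A where "F = {A}" by (auto simp: card_Suc_eq)
  then show ?case by simp
next
  case (Suc r)
  define R where "R = real (Suc (Suc r))"
  define E where "E = (\<Sum>A\<in>F. eps A)"
  \<comment> \<open>Chosen so that the slack \<open>d * E\<close>, summed over the
    \<open>R * (R - 1)\<close> ordered pairs, is \<open>2 * E\<close>; the average then meets the
    bound \<open>2 * R * E\<close> of \<open>merge_pairs\<close> exactly.\<close>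
  define d where "d = 2 / (R * (R - 1))"
  have R: "R \<ge> 2" by (simp add: R_def)
  have eps0: "eps A \<ge> 0" if "A \<subseteq> S" for A
    using sum_sqrt_mult_le_1[of "P {}" "P A" T] nn one[of "{}"] one[OF that] by (simp add: eps)
  \<comment> \<open>Averaging the previous lemma over all ordered pairs: some pair merges at small extra cost.\<close>
  have "\<exists>A\<in>F. \<exists>B\<in>F - {A}. eps (A \<union> B) \<le> eps A + eps B + d * E"
  proof (rule ccontr)
    assume "\<not> ?thesis"
    then have less: "eps A + eps B + d * E < eps (A \<union> B)" if "A \<in> F" "B \<in> F - {A}" for A B
      using that by force
    have cardm: "card (F - {A}) = Suc r" if "A \<in> F" for A
      using that Suc.prems by simp
    have "(\<Sum>A\<in>F. \<Sum>B\<in>F - {A}. eps A + eps B + d * E) < (\<Sum>A\<in>F. \<Sum>B\<in>F - {A}. eps (A \<union> B))"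
    proof (intro sum_strict_mono)
      show "F - {A} \<noteq> {}" if "A \<in> F" for A using cardm[OF that] by force
    qed (use Suc.prems less in auto)
    also have "\<dots> \<le> 2 * real (card F) * (\<Sum>A\<in>F. eps A)"
      by (rule merge_pairs[OF T nn one paste eps]) (use Suc.prems in auto)
    also have "\<dots> = 2 * R * E" by (simp add: R_def E_def Suc.prems)
    finally have lt: "(\<Sum>A\<in>F. \<Sum>B\<in>F - {A}. eps A + eps B + d * E) < 2 * R * E" .
    have "(\<Sum>A\<in>F. \<Sum>B\<in>F - {A}. eps A + eps B + d * E)
        = (\<Sum>A\<in>F. (R - 1) * eps A + (E - eps A) + (R - 1) * (d * E))"
    proof (intro sum.cong refl)
      fix A assume A: "A \<in> F"
      have "(\<Sum>B\<in>F - {A}. eps B) = E - eps A"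
        unfolding E_def by (subst sum.remove[OF Suc.prems(1) A]) simp
      then show "(\<Sum>B\<in>F - {A}. eps A + eps B + d * E) = (R - 1) * eps A + (E - eps A) + (R - 1) * (d * E)"
        using cardm[OF A] by (simp add: sum.distrib R_def algebra_simps)
    qed
    also have "\<dots> = (R - 1) * E + (R * E - E) + R * ((R - 1) * (d * E))"
      using Suc.prems(4) by (simp add: sum.distrib sum_subtractf E_def R_def flip: sum_distrib_left)
    also have "R * ((R - 1) * (d * E)) = 2 * E" using R by (simp add: d_def)
    finally show False using lt by (simp add: algebra_simps)
  qed
  then obtain A B where AB: "A \<in> F" "B \<in> F" "A \<noteq> B" "eps (A \<union> B) \<le> eps A + eps B + d * E"
    by auto
  define F' where "F' = insert (A \<union> B) (F - {A, B})"
  \<comment> \<open>Disjoint non-empty parts: the merged set is not already present, so the family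
    shrinks by exactly one.\<close>
  have notin: "A \<union> B \<notin> F - {A, B}"
  proof
    assume "A \<union> B \<in> F - {A, B}"
    then have "disjnt (A \<union> B) A" using AB Suc.prems(3) by (metis Diff_iff insertCI pairwiseD)
    then have "A = {}" by (auto simp: disjnt_def)
    then show False using Suc.prems(2) AB by auto
  qed
  have UF: "\<Union>F' = \<Union>F" using AB by (auto simp: F'_def)
  have sumF: "(\<Sum>A\<in>F - {A, B}. eps A) = E - eps A - eps B"
  proof -
    have "F - {A, B} = (F - {A}) - {B}" by auto
    then show ?thesis unfolding E_def
      using AB Suc.prems(1) by (simp add: sum_diff1)
  qed
  have "card (F - {A, B}) = r" using AB Suc.prems by (simp add: card_Diff_subset)
  then have cardF': "card F' = Suc r" using notin Suc.prems(1) by (simp add: F'_def)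
  have "pairwise disjnt F'"
    using Suc.prems(3) AB unfolding F'_def by (auto simp: pairwise_def disjnt_def)
  then have "eps (\<Union>F') \<le> exp (2 - 2 / real (Suc r)) * (\<Sum>A\<in>F'. eps A)"
    using Suc.prems AB cardF' by (intro Suc.IH) (auto simp: F'_def)
  also have "(\<Sum>A\<in>F'. eps A) = eps (A \<union> B) + (E - eps A - eps B)"
    unfolding F'_def using notin Suc.prems(1) sumF by simp
  also have "\<dots> \<le> (1 + d) * E" using AB(4) by (simp add: algebra_simps)
  finally have 1: "eps (\<Union>F) \<le> exp (2 - 2 / real (Suc r)) * ((1 + d) * E)"
    unfolding UF by simp
  have "E \<ge> 0" unfolding E_def using Suc.prems eps0 by (intro sum_nonneg) auto
  then have "(1 + d) * E \<le> exp d * E" by (intro mult_right_mono) auto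
  then have "exp (2 - 2 / real (Suc r)) * ((1 + d) * E) \<le> exp (2 - 2 / real (Suc r)) * (exp d * E)"
    by (intro mult_left_mono) auto
  also have "\<dots> = exp (2 - 2 / real (Suc r) + d) * E" by (simp add: exp_add)
  also have "2 - 2 / real (Suc r) + d = 2 - 2 / R"
  proof -
    have "real (Suc r) = R - 1" by (simp add: R_def)
    moreover have "2 - 2 / (R - 1) + 2 / (R * (R - 1)) = 2 - 2 / R"
      using R by (simp add: divide_simps) (simp add: algebra_simps)
    ultimately show ?thesis unfolding d_def by (simp only:)
  qed
  finally show ?case using 1 unfolding R_def E_def by linarith
qed

lemma eps_le_sum_singletons:
  fixes P :: "'a set \<Rightarrow> 'b \<Rightarrow> real"
  assumes T: "finite T"
    and nn: "\<And>A \<tau>. P A \<tau> \<ge> 0"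
    and one: "\<And>A. A \<subseteq> S \<Longrightarrow> (\<Sum>\<tau>\<in>T. P A \<tau>) = 1"
    and paste: "\<And>A B \<tau>. A \<subseteq> S \<Longrightarrow> B \<subseteq> S \<Longrightarrow> A \<inter> B = {} \<Longrightarrow> P {} \<tau> * P (A \<union> B) \<tau> = P A \<tau> * P B \<tau>"
    and eps: "\<And>A. eps A = 1 - (\<Sum>\<tau>\<in>T. sqrt (P {} \<tau> * P A \<tau>))"
    and S: "finite S"
  shows "eps S \<le> exp 2 * (\<Sum>u\<in>S. eps {u})"
proof (cases "S = {}")
  case True
  then show ?thesis using one[of "{}"] nn by (simp add: eps)
next
  case False
  define F where "F = (\<lambda>u. {u}) ` S"
  have card: "card F = Suc (card S - 1)"
    using S False unfolding F_def by (simp add: card_image card_gt_0_iff)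
  have eps0: "eps {u} \<ge> 0" if "u \<in> S" for u
    using sum_sqrt_mult_le_1[of "P {}" "P {u}" T] nn one[of "{}"] one[of "{u}"] that by (simp add: eps)
  have "eps (\<Union>F) \<le> exp (2 - 2 / real (Suc (card S - 1))) * (\<Sum>A\<in>F. eps A)"
    by (rule eps_Union_le[where P=P, OF T nn one paste eps _ _ _ card]) (use S in \<open>auto simp: F_def pairwise_def\<close>)
  also have "(\<Sum>A\<in>F. eps A) = (\<Sum>u\<in>S. eps {u})"
    unfolding F_def by (subst sum.reindex) (auto simp: inj_on_def)
  also have "exp (2 - 2 / real (Suc (card S - 1))) * \<dots> \<le> exp 2 * \<dots>"
    using eps0 by (intro mult_right_mono sum_nonneg) auto
  finally show ?thesis by (simp add: F_def)
qed

subsection \<open>Information carried by a bounded number of values\<close>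

text \<open>Subadditivity of entropy. For \<open>X\<close> uniform on \<open>R\<close>, each summand
  on the left is at most half the relative entropy of the law of \<open>X u\<close> from uniform.
  These relative entropies add up to at most the entropy deficit of \<open>R\<close> inside the cube
  over \<open>J\<close>, which is the logarithm on the right.\<close>

lemma hellinger_le_relative_density:
  fixes R :: "('i \<Rightarrow> nat) set"
  assumes R: "finite R" "R \<noteq> {}" and J: "finite J"
    and range: "\<And>X u. X \<in> R \<Longrightarrow> u \<in> J \<Longrightarrow> X u < n"
    and outside: "\<And>X Y u. X \<in> R \<Longrightarrow> Y \<in> R \<Longrightarrow> u \<notin> J \<Longrightarrow> X u = Y u"
  shows "(\<Sum>u\<in>J. 1 - (\<Sum>x<n. sqrt (real (card {X\<in>R. X u = x}) / (real (card R) * real n))))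
           \<le> ln (real n ^ card J / real (card R)) / 2"
proof -
  define m where "m = real (card R)"
  \<comment> \<open>\<open>q u\<close> is the law of the coordinate \<open>X u\<close> for
    \<open>X\<close> uniform on \<open>R\<close>.\<close>
  define q where "q = (\<lambda>u x. real (card {X\<in>R. X u = x}) / m)"
  have m: "m > 0" using R by (simp add: m_def card_gt_0_iff)
  show ?thesis
  proof (cases "J = {}")
    \<comment> \<open>Treated apart because \<open>n > 0\<close> is read off from a coordinate in
      \<open>J\<close>. Here \<open>R\<close> is a single stream and both sides are 0.\<close>
    case True
    have "card R \<le> 1"
    proof -
      obtain X where X: "X \<in> R" using R by auto
      have "R \<subseteq> {X}" using outside[OF _ X] True by (auto intro!: ext)
      then show ?thesis using card_mono[of "{X}" R] by simp
    qed
    then have "m = 1" using m by (simp add: m_def)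
    then show ?thesis using True by (simp add: m_def)
  next
    case False
    then have n: "n > 0" using R range by fastforce
    have qpos: "q u (X u) > 0" if "X \<in> R" for X u
    proof -
      have "card {Y\<in>R. Y u = X u} > 0" using that R by (auto simp: card_gt_0_iff)
      then show ?thesis using m by (simp add: q_def)
    qed
    have avg: "(\<Sum>x<n. q u x * g x) = (\<Sum>X\<in>R. g (X u)) / m" if u: "u \<in> J" for u and g :: "nat \<Rightarrow> real"
    proof -
      have "(\<Sum>X\<in>R. g (X u)) = (\<Sum>x<n. \<Sum>X\<in>{X\<in>R. X u = x}. g (X u))"
        by (rule sum.group[symmetric]) (use R range u in auto)
      also have "\<dots> = (\<Sum>x<n. real (card {X\<in>R. X u = x}) * g x)"
        by (intro sum.cong refl) simp
      finally show ?thesis unfolding q_def by (simp add: sum_divide_distrib)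
    qed
    have point: "1 - (\<Sum>x<n. sqrt (q u x / real n)) \<le> (\<Sum>X\<in>R. ln (real n * q u (X u))) / m / 2"
      if u: "u \<in> J" for u
    proof -
      have "(\<Sum>x<n. sqrt (q u x / real n)) = (\<Sum>x<n. q u x * (1 / sqrt (real n * q u x)))"
      proof (intro sum.cong refl)
        fix x
        have q0: "q u x \<ge> 0" using m by (simp add: q_def)
        show "sqrt (q u x / real n) = q u x * (1 / sqrt (real n * q u x))"
        proof (cases "q u x = 0")
          case False
          then have "q u x = sqrt (q u x) * sqrt (q u x)" using q0 by simp
          then show ?thesis using False q0 n
            by (simp add: real_sqrt_divide real_sqrt_mult field_simps)
        qed simp
      qed
      also have "\<dots> = (\<Sum>X\<in>R. 1 / sqrt (real n * q u (X u))) / m" by (rule avg[OF u])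
      finally have 1: "1 - (\<Sum>x<n. sqrt (q u x / real n)) = (\<Sum>X\<in>R. 1 - 1 / sqrt (real n * q u (X u))) / m"
        using m by (simp add: sum_subtractf diff_divide_distrib) (simp add: m_def)
      have "(\<Sum>X\<in>R. 1 - 1 / sqrt (real n * q u (X u))) \<le> (\<Sum>X\<in>R. ln (real n * q u (X u)) / 2)"
      proof (rule sum_mono)
        fix X assume X: "X \<in> R"
        define z where "z = real n * q u (X u)"
        have z: "z > 0" using qpos[OF X] n by (simp add: z_def)
        \<comment> \<open>The inequality \<open>ln y \<le> y - 1\<close> at
          \<open>y = 1 / sqrt z\<close> is what passes from Hellinger distance to relative
          entropy.\<close>
        have "ln (1 / sqrt z) \<le> 1 / sqrt z - 1" using z by (intro ln_le_minus_one) simp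
        moreover have "ln (1 / sqrt z) = - (ln z / 2)" using z by (simp add: ln_div ln_sqrt)
        ultimately show "1 - 1 / sqrt z \<le> ln z / 2" by linarith
      qed
      also have "\<dots> = (\<Sum>X\<in>R. ln (real n * q u (X u))) / 2" by (simp add: sum_divide_distrib)
      finally show ?thesis unfolding 1 using m by (simp add: divide_right_mono field_simps)
    qed
    define Q where "Q = (\<lambda>X. \<Prod>u\<in>J. q u (X u))"
    have sumq: "(\<Sum>x<n. q u x) = 1" if "u \<in> J" for u
      using avg[OF that, of "\<lambda>_. 1"] m by (simp add: m_def)
    \<comment> \<open>\<open>Q\<close> is the product of the marginals, a probability distribution
      on the cube over \<open>J\<close>; \<open>R\<close> embeds into that cube because its members
      agree outside \<open>J\<close>.\<close>
    have Qle: "(\<Sum>X\<in>R. Q X) \<le> 1"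
    proof -
      have inj: "inj_on (\<lambda>X. restrict X J) R"
      proof (rule inj_onI)
        fix X Y assume XY: "X \<in> R" "Y \<in> R" "restrict X J = restrict Y J"
        show "X = Y"
        proof
          fix u show "X u = Y u"
            using XY outside[OF XY(1,2), of u] by (cases "u \<in> J") (metis restrict_apply', auto)
        qed
      qed
      have "(\<Sum>X\<in>R. Q X) = (\<Sum>g\<in>(\<lambda>X. restrict X J) ` R. Q g)"
        by (subst sum.reindex[OF inj]) (simp add: Q_def)
      also have "\<dots> \<le> (\<Sum>g\<in>PiE J (\<lambda>_. {..<n}). Q g)"
        using range m J by (intro sum_mono2) (auto simp: Q_def q_def intro!: prod_nonneg finite_PiE)
      also have "\<dots> = (\<Prod>u\<in>J. \<Sum>x<n. q u x)"
        unfolding Q_def using J by (subst prod_sum_PiE) auto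
      also have "\<dots> = 1" using sumq by simp
      finally show ?thesis .
    qed
    have Qpos: "Q X > 0" if "X \<in> R" for X
      unfolding Q_def using qpos[OF that] by (intro prod_pos) auto
    have "(\<Sum>u\<in>J. 1 - (\<Sum>x<n. sqrt (q u x / real n)))
        \<le> (\<Sum>u\<in>J. (\<Sum>X\<in>R. ln (real n * q u (X u))) / m / 2)"
      by (intro sum_mono point)
    also have "\<dots> = (\<Sum>X\<in>R. \<Sum>u\<in>J. ln (real n * q u (X u))) / m / 2"
      by (simp add: sum_divide_distrib sum.swap[of _ J R])
    \<comment> \<open>The entropy deficit is split off. What remains is the average of
      \<open>ln (m * Q X)\<close>, which is at most 0 by Gibbs' inequality, that is, by
      \<open>ln y \<le> y - 1\<close> and \<open>Qle\<close>.\<close>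
    also have "\<dots> = (\<Sum>X\<in>R. ln (real n ^ card J / m) + ln (m * Q X)) / m / 2"
    proof (intro arg_cong[where f="\<lambda>z. z / m / 2"] sum.cong refl)
      fix X assume X: "X \<in> R"
      have "(\<Sum>u\<in>J. ln (real n * q u (X u))) = (\<Sum>u\<in>J. ln (real n) + ln (q u (X u)))"
        using qpos[OF X] n by (intro sum.cong refl) (simp add: ln_mult_pos)
      also have "\<dots> = real (card J) * ln (real n) + ln (Q X)"
        unfolding Q_def using qpos[OF X, THEN less_imp_neq] J by (subst ln_prod) (auto simp: sum.distrib)
      also have "\<dots> = ln (real n ^ card J / m) + ln (m * Q X)"
        using n m Qpos[OF X] by (simp add: ln_mult ln_div ln_realpow)
      finally show "(\<Sum>u\<in>J. ln (real n * q u (X u))) = ln (real n ^ card J / m) + ln (m * Q X)" .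
    qed
    also have "\<dots> \<le> (\<Sum>X\<in>R. ln (real n ^ card J / m) + (m * Q X - 1)) / m / 2"
      using m Qpos by (intro divide_right_mono sum_mono add_left_mono ln_le_minus_one) auto
    also have "\<dots> = ln (real n ^ card J / m) / 2 + ((\<Sum>X\<in>R. Q X) - 1) / 2"
      using m by (simp add: sum.distrib sum_subtractf flip: sum_distrib_left) (simp add: m_def field_simps)
    also have "\<dots> \<le> ln (real n ^ card J / m) / 2" using Qle by simp
    finally show ?thesis unfolding q_def m_def by (simp add: field_simps)
  qed
qed

section \<open>Uniform streams and planted positions\<close>

definition all_streams :: "nat \<Rightarrow> nat \<Rightarrow> (nat \<Rightarrow> nat) set" where
  "all_streams n t = PiE_dflt {0..<t} 0 (\<lambda>_. {0..<n})"

lemma all_streams_iff: "X \<in> all_streams n t \<longleftrightarrow> (\<forall>i. if i < t then X i < n else X i = 0)"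
  by (auto simp: all_streams_def PiE_dflt_def)

lemma finite_all_streams [simp]: "finite (all_streams n t)"
  unfolding all_streams_def by auto

lemma card_all_streams: "card (all_streams n t) = n ^ t"
  unfolding all_streams_def by (simp add: card_PiE_dflt)

definition plant :: "nat set \<Rightarrow> nat \<Rightarrow> (nat \<Rightarrow> nat) \<Rightarrow> nat \<Rightarrow> nat" where
  "plant T x X = (\<lambda>i. if i \<in> T then x else X i)"

lemma plant_in_streams: "X \<in> all_streams n t \<Longrightarrow> T \<subseteq> {..<t} \<Longrightarrow> x < n \<Longrightarrow> plant T x X \<in> all_streams n t"
  by (auto simp: all_streams_iff plant_def)

lemma plant_empty [simp]: "plant {} x X = X"
  by (simp add: plant_def)

text \<open>Planting at \<open>u\<close> discards the old symbol there, so every stream with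
  \<open>X u = x\<close> has \<open>n\<close> preimages. The bijection keeps the discarded symbol as
  a second component. Planting at one position thus amounts to conditioning on
  \<open>X u = x\<close>.\<close>

lemma card_plant_singleton:
  assumes u: "u < t" and x: "x < n"
  shows "card {X\<in>all_streams n t. F (plant {u} x X) = \<tau>} = n * card {X\<in>all_streams n t. F X = \<tau> \<and> X u = x}"
proof -
  let ?A = "{X\<in>all_streams n t. F X = \<tau> \<and> X u = x}"
  have "bij_betw (\<lambda>(X, y). X(u := y)) (?A \<times> {..<n}) {X\<in>all_streams n t. F (plant {u} x X) = \<tau>}"
  proof (rule bij_betw_byWitness[where f' = "\<lambda>X. (plant {u} x X, X u)"])
    show "\<forall>a\<in>?A \<times> {..<n}. (plant {u} x ((\<lambda>(X, y). X(u := y)) a), (\<lambda>(X, y). X(u := y)) a u) = a"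
      by (auto simp: plant_def)
    show "\<forall>a'\<in>{X\<in>all_streams n t. F (plant {u} x X) = \<tau>}.
        (\<lambda>(X, y). X(u := y)) (plant {u} x a', a' u) = a'"
      by (auto simp: plant_def)
    have "plant {u} x (X(u := y)) = X" if "X u = x" for X y using that by (auto simp: plant_def)
    then show "(\<lambda>(X, y). X(u := y)) ` (?A \<times> {..<n}) \<subseteq> {X\<in>all_streams n t. F (plant {u} x X) = \<tau>}"
      using u by (auto simp: all_streams_iff)
    show "(\<lambda>X. (plant {u} x X, X u)) ` {X\<in>all_streams n t. F (plant {u} x X) = \<tau>} \<subseteq> ?A \<times> {..<n}"
      using u x by (force simp: all_streams_iff plant_def)
  qed
  then have "card (?A \<times> {..<n}) = card {X\<in>all_streams n t. F (plant {u} x X) = \<tau>}"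
    by (rule bij_betw_same_card)
  then show ?thesis by (simp add: card_cartesian_product mult.commute)
qed

text \<open>A message that reveals the stream outside \<open>J\<close> and takes at most
  \<open>M\<close> values per outside configuration on average carries at most \<open>ln M\<close>
  nats about the positions in \<open>J\<close>. The loss at \<open>u\<close>, averaged over
  \<open>x\<close>, is the average over the fibres of \<open>F\<close> of the Hellinger terms
  bounded in \<open>hellinger_le_relative_density\<close>.\<close>

lemma sum_hellinger_le_log_card_range:
  fixes F :: "(nat \<Rightarrow> nat) \<Rightarrow> 'b"
  assumes n: "n > 0" and J: "J \<subseteq> {..<t}" and M: "M > 0"
    and outside: "\<And>X Y u. X \<in> all_streams n t \<Longrightarrow> Y \<in> all_streams n t \<Longrightarrow> F X = F Y \<Longrightarrow> u \<notin> J \<Longrightarrow> X u = Y u"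
    and card_range: "card (F ` all_streams n t) \<le> M * n ^ (t - card J)"
  shows "(\<Sum>u\<in>J. (\<Sum>x<n. 1 - bhatt (all_streams n t) F (\<lambda>X. F (plant {u} x X))) / real n) \<le> ln (real M) / 2"
proof -
  define \<Omega> where "\<Omega> = all_streams n t"
  define N where "N = real n ^ t"
  define R where "R = (\<lambda>\<tau>. {X\<in>\<Omega>. F X = \<tau>})"
  define T where "T = F ` \<Omega>"
  have finJ: "finite J" using J finite_subset by blast
  have cJ: "card J \<le> t" using card_mono[OF _ J] by simp
  have N: "N > 0" "real (card \<Omega>) = N" using n by (auto simp: N_def \<Omega>_def card_all_streams)
  have finT: "finite T" by (simp add: T_def \<Omega>_def)
  have Rne: "R \<tau> \<noteq> {}" if "\<tau> \<in> T" for \<tau> using that by (auto simp: R_def T_def)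
  have Rfin: "finite (R \<tau>)" for \<tau> by (simp add: R_def \<Omega>_def)
  have Rpos: "real (card (R \<tau>)) > 0" if "\<tau> \<in> T" for \<tau> using Rne[OF that] Rfin by (simp add: card_gt_0_iff)
  have tot: "(\<Sum>\<tau>\<in>T. real (card (R \<tau>))) = N"
    using sum_card_fibres[of \<Omega> T F "\<lambda>_. True"] finT N by (simp add: R_def T_def \<Omega>_def)
  have bh: "bhatt \<Omega> F (\<lambda>X. F (plant {u} x X))
      = (\<Sum>\<tau>\<in>T. real (card (R \<tau>)) / N * (real n * sqrt (real (card {X\<in>R \<tau>. X u = x}) / (real (card (R \<tau>)) * real n))))"
    if u: "u \<in> J" and x: "x < n" for u x
  proof -
    have ut: "u < t" using u J by auto
    have sub: "F ` \<Omega> \<union> (\<lambda>X. F (plant {u} x X)) ` \<Omega> \<subseteq> T"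
      using plant_in_streams[of _ n t "{u}" x] ut x by (auto simp: T_def \<Omega>_def)
    have "bhatt \<Omega> F (\<lambda>X. F (plant {u} x X))
      = (\<Sum>\<tau>\<in>T. sqrt (real (card (R \<tau>)) * (real n * real (card {X\<in>R \<tau>. X u = x})))) / N"
      unfolding bhatt_superset[OF finT sub] N(2)
      unfolding \<Omega>_def card_plant_singleton[OF ut x] R_def by (simp add: conj_assoc)
    also have "\<dots> = (\<Sum>\<tau>\<in>T. real (card (R \<tau>)) / N * (real n * sqrt (real (card {X\<in>R \<tau>. X u = x}) / (real (card (R \<tau>)) * real n))))"
      unfolding sum_divide_distrib
    proof (intro sum.cong refl)
      fix \<tau> assume \<tau>: "\<tau> \<in> T"
      define a where "a = real (card (R \<tau>))"
      define c where "c = real (card {X\<in>R \<tau>. X u = x})"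
      have a: "a > 0" using Rpos[OF \<tau>] by (simp add: a_def)
      have "sqrt (a * (real n * c)) = sqrt ((a * real n)\<^sup>2 * (c / (a * real n)))"
        using a n by (simp add: power2_eq_square)
      also have "\<dots> = a * real n * sqrt (c / (a * real n))"
        using a n by (simp only: real_sqrt_mult real_sqrt_abs) simp
      finally show "sqrt (a * (real n * c)) / N = a / N * (real n * sqrt (c / (a * real n)))"
        by simp
    qed
    finally show ?thesis .
  qed
  have "(\<Sum>u\<in>J. (\<Sum>x<n. 1 - bhatt \<Omega> F (\<lambda>X. F (plant {u} x X))) / real n)
    = (\<Sum>u\<in>J. \<Sum>\<tau>\<in>T. real (card (R \<tau>)) / N *
         (1 - (\<Sum>x<n. sqrt (real (card {X\<in>R \<tau>. X u = x}) / (real (card (R \<tau>)) * real n)))))"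
  proof (intro sum.cong refl)
    fix u assume u: "u \<in> J"
    define s where "s = (\<lambda>\<tau> x. sqrt (real (card {X\<in>R \<tau>. X u = x}) / (real (card (R \<tau>)) * real n)))"
    have "(\<Sum>x<n. 1 - bhatt \<Omega> F (\<lambda>X. F (plant {u} x X))) / real n
       = 1 - (\<Sum>x<n. bhatt \<Omega> F (\<lambda>X. F (plant {u} x X))) / real n"
      using n by (simp add: sum_subtractf field_simps)
    also have "(\<Sum>x<n. bhatt \<Omega> F (\<lambda>X. F (plant {u} x X)))
       = (\<Sum>x<n. \<Sum>\<tau>\<in>T. real (card (R \<tau>)) / N * (real n * s \<tau> x))"
      using bh[OF u] by (simp add: s_def)
    also have "\<dots> = (\<Sum>\<tau>\<in>T. real (card (R \<tau>)) / N * (\<Sum>x<n. s \<tau> x)) * real n"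
      by (subst sum.swap) (simp add: sum_distrib_left sum_distrib_right sum_divide_distrib mult_ac)
    also have "1 - \<dots> / real n = (\<Sum>\<tau>\<in>T. real (card (R \<tau>)) / N) - (\<Sum>\<tau>\<in>T. real (card (R \<tau>)) / N * (\<Sum>x<n. s \<tau> x))"
      using n N tot by (simp flip: sum_divide_distrib)
    also have "\<dots> = (\<Sum>\<tau>\<in>T. real (card (R \<tau>)) / N * (1 - (\<Sum>x<n. s \<tau> x)))"
      by (simp add: sum_subtractf right_diff_distrib)
    finally show "(\<Sum>x<n. 1 - bhatt \<Omega> F (\<lambda>X. F (plant {u} x X))) / real n
       = (\<Sum>\<tau>\<in>T. real (card (R \<tau>)) / N * (1 - (\<Sum>x<n. s \<tau> x)))" .
  qed
  also have "\<dots> = (\<Sum>\<tau>\<in>T. real (card (R \<tau>)) / N *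
         (\<Sum>u\<in>J. 1 - (\<Sum>x<n. sqrt (real (card {X\<in>R \<tau>. X u = x}) / (real (card (R \<tau>)) * real n)))))"
    by (subst sum.swap) (simp add: sum_distrib_left)
  also have "\<dots> \<le> (\<Sum>\<tau>\<in>T. real (card (R \<tau>)) / N * (ln (real n ^ card J / real (card (R \<tau>))) / 2))"
  proof (intro sum_mono mult_left_mono)
    fix \<tau> assume \<tau>: "\<tau> \<in> T"
    show "(\<Sum>u\<in>J. 1 - (\<Sum>x<n. sqrt (real (card {X\<in>R \<tau>. X u = x}) / (real (card (R \<tau>)) * real n))))
        \<le> ln (real n ^ card J / real (card (R \<tau>))) / 2"
    proof (rule hellinger_le_relative_density[OF Rfin Rne[OF \<tau>] finJ])
      show "X u < n" if "X \<in> R \<tau>" "u \<in> J" for X u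
        using that J by (auto simp: R_def \<Omega>_def all_streams_iff subset_eq)
      show "X u = Y u" if "X \<in> R \<tau>" "Y \<in> R \<tau>" "u \<notin> J" for X Y u
        using that outside[of X Y u] by (auto simp: R_def \<Omega>_def)
    qed
  qed (use N in auto)
  \<comment> \<open>Jensen for the logarithm, by its tangent at \<open>real M\<close>: the
    correction averages to at most 0 because the number of fibres is bounded by
    \<open>card_range\<close>.\<close>
  also have "\<dots> \<le> (\<Sum>\<tau>\<in>T. real (card (R \<tau>)) / N * ((ln (real M) + (real n ^ card J / (real (card (R \<tau>)) * real M) - 1)) / 2))"
  proof (intro sum_mono mult_left_mono divide_right_mono)
    fix \<tau> assume \<tau>: "\<tau> \<in> T"
    define w where "w = real n ^ card J / real (card (R \<tau>))"
    have w: "w > 0" using Rpos[OF \<tau>] n by (simp add: w_def)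
    have "ln (w / real M) \<le> w / real M - 1" using w M by (intro ln_le_minus_one) simp
    moreover have "ln (w / real M) = ln w - ln (real M)" using w M by (simp add: ln_div)
    moreover have "w / real M = real n ^ card J / (real (card (R \<tau>)) * real M)" by (simp add: w_def)
    ultimately show "ln (real n ^ card J / real (card (R \<tau>)))
       \<le> ln (real M) + (real n ^ card J / (real (card (R \<tau>)) * real M) - 1)"
      unfolding w_def[symmetric] by linarith
  qed (use N in auto)
  also have "\<dots> = (\<Sum>\<tau>\<in>T. real (card (R \<tau>)) / N * ((ln (real M) - 1) / 2) + real n ^ card J / (N * real M) / 2)"
    using Rpos N M by (intro sum.cong refl) (simp add: field_simps)
  also have "\<dots> = (ln (real M) - 1) / 2 + real (card T) * real n ^ card J / (N * real M) / 2"
    using tot N by (simp add: sum.distrib flip: sum_distrib_right sum_divide_distrib)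
  also have "\<dots> \<le> ln (real M) / 2"
  proof -
    have "real (card T) \<le> real M * real n ^ (t - card J)"
      using card_range unfolding T_def \<Omega>_def by (metis of_nat_le_iff of_nat_mult of_nat_power)
    then have "real (card T) * real n ^ card J \<le> real M * real n ^ (t - card J) * real n ^ card J"
      by (rule mult_right_mono) simp
    also have "\<dots> = N * real M" using cJ by (simp add: N_def flip: power_add)
    finally show ?thesis using N M by (simp add: field_simps)
  qed
  finally show ?thesis unfolding \<Omega>_def .
qed

subsection \<open>Transcripts\<close>

text \<open>All passes are put on one time axis: time \<open>m\<close> lies in pass
  \<open>m div t\<close>, just before position \<open>m mod t\<close> is read.\<close>

primrec state_at :: "(nat \<Rightarrow> nat \<Rightarrow> nat \<Rightarrow> nat \<Rightarrow> nat) \<Rightarrow> nat \<Rightarrow> nat \<Rightarrow> (nat \<Rightarrow> nat) \<Rightarrow> nat \<Rightarrow> nat" where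
  "state_at step init t X 0 = init"
| "state_at step init t X (Suc m) =
     step (m div t) (m mod t) (state_at step init t X m) (X (m mod t))"

lemma stream_run_eq_state_at:
  "stream_run step init l t X = state_at step init t X (l * t)"
proof (induction l)
  case 0
  then show ?case by (simp add: stream_run_def)
next
  case (Suc l)
  have "fold (\<lambda>i st'. step l i st' (X i)) [0..<k] (state_at step init t X (l * t))
        = state_at step init t X (l * t + k)" if "k \<le> t" for k
    using that
  proof (induction k)
    case (Suc k)
    then have "(l * t + k) div t = l" "(l * t + k) mod t = k" by auto
    with Suc show ?case by simp
  qed simp
  from this[of t] show ?case using Suc by (simp add: stream_run_def add.commute)
qed

text \<open>In every pass the state just before a position of \<open>D\<close> is withheld. Withheld
  entries and times after the end are 0, so equality of transcripts means agreement of all published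
  states.\<close>

definition transcript ::
  "(nat \<Rightarrow> nat \<Rightarrow> nat \<Rightarrow> nat \<Rightarrow> nat) \<Rightarrow> nat \<Rightarrow> nat \<Rightarrow> nat \<Rightarrow> nat set \<Rightarrow> (nat \<Rightarrow> nat) \<Rightarrow> nat \<Rightarrow> nat" where
  "transcript step init l t D X =
     (\<lambda>m. if m \<le> l * t \<and> m mod t \<notin> D then state_at step init t X m else 0)"

text \<open>A position is hidden when it and its predecessor both lie in \<open>J\<close>: the state just
  before reading it is then omitted from the transcript, so that an interval is crossed unobserved.\<close>

definition hidden :: "nat set \<Rightarrow> nat set" where
  "hidden J = {i. \<exists>i'. i = Suc i' \<and> i \<in> J \<and> i' \<in> J}"

definition mix :: "nat set \<Rightarrow> (nat \<Rightarrow> nat) \<Rightarrow> (nat \<Rightarrow> nat) \<Rightarrow> nat \<Rightarrow> nat" where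
  "mix U X Y = (\<lambda>i. if i \<in> U then Y i else X i)"

lemma transcript_eqD:
  assumes "transcript step init l t D X = transcript step init l t D Y" "m \<le> l * t" "m mod t \<notin> D"
  shows "state_at step init t X m = state_at step init t Y m"
  using fun_cong[OF assms(1), of m] assms(2,3) by (simp add: transcript_def)

lemma Suc_mod_less: "t > 0 \<Longrightarrow> Suc (m mod t) < t \<Longrightarrow> Suc m mod t = Suc (m mod t)"
  by (simp add: mod_Suc)

text \<open>The rectangle property of protocols: the run on the mixed stream follows the run on
  \<open>Y\<close> while inside \<open>U\<close> and the run on \<open>X\<close> while outside.
  Wherever it changes from one to the other the state is published, hence common to both.\<close>

lemma transcript_mix:
  assumes t: "t > 0" and D0: "0 \<notin> D"
    and cut: "\<And>i. Suc i < t \<Longrightarrow> (Suc i \<in> U) \<noteq> (i \<in> U) \<Longrightarrow> Suc i \<notin> D"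
    and eq: "transcript step init l t D X = transcript step init l t D Y"
  shows "transcript step init l t D (mix U X Y) = transcript step init l t D X"
proof -
  let ?s = "state_at step init t"
  have main: "?s (mix U X Y) m = (if m mod t \<in> U then ?s Y m else ?s X m)" if "m \<le> l * t" for m
    using that
  proof (induction m)
    case (Suc m)
    have IH: "?s (mix U X Y) m = (if m mod t \<in> U then ?s Y m else ?s X m)" using Suc by simp
    have s: "?s (mix U X Y) (Suc m) = (if m mod t \<in> U then ?s Y (Suc m) else ?s X (Suc m))"
      using IH by (simp add: mix_def)
    show ?case
    proof (cases "(Suc m mod t \<in> U) = (m mod t \<in> U)")
      case False
      have "Suc m mod t \<notin> D"
      proof (cases "Suc (m mod t) < t")
        case True
        with False cut[of "m mod t"] show ?thesis by (simp add: Suc_mod_less[OF t True])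
      next
        \<comment> \<open>From the last position of a pass the run wraps around to position 0, which
          is never withheld.\<close>
        case False
        then have "Suc m mod t = 0" using t by (simp add: mod_Suc) (metis Suc_lessI mod_less_divisor)
        then show ?thesis using D0 by simp
      qed
      then have "?s X (Suc m) = ?s Y (Suc m)" using eq Suc.prems by (intro transcript_eqD)
      then show ?thesis unfolding s by (simp only: if_cancel)
    next
      case True
      show ?thesis using s unfolding True .
    qed
  qed simp
  show ?thesis
  proof
    fix m
    show "transcript step init l t D (mix U X Y) m = transcript step init l t D X m"
    proof (cases "m \<le> l * t \<and> m mod t \<notin> D")
      case True
      then show ?thesis using main[of m] transcript_eqD[OF eq, of m] by (simp add: transcript_def)
    qed (simp only: transcript_def if_False)
  qed
qed

lemma mix_in_streams: "X \<in> all_streams n t \<Longrightarrow> Y \<in> all_streams n t \<Longrightarrow> mix U X Y \<in> all_streams n t"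
  by (auto simp: all_streams_iff mix_def)

lemma mix_mix [simp]: "mix U (mix U X Y) (mix U Y X) = X"
  by (auto simp: mix_def)

text \<open>Exchanging the blocks of \<open>B\<close> between two streams with the same transcript is a bijection
  on pairs of streams.\<close>

lemma transcript_cut_and_paste:
  fixes J :: "nat \<Rightarrow> nat set" and \<tau> :: "nat \<Rightarrow> nat" and step init l n x
  assumes t: "t > 0" and AB: "A \<inter> B = {}" "A \<subseteq> S" "B \<subseteq> S"
    and mem: "\<And>u. u \<in> S \<Longrightarrow> u \<in> J u"
    and disj: "\<And>u v. u \<in> S \<Longrightarrow> v \<in> S \<Longrightarrow> u \<noteq> v \<Longrightarrow> J u \<inter> J v = {}"
  defines "tr \<equiv> transcript step init l t (\<Union>u\<in>S. hidden (J u))"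
    and "c \<equiv> \<lambda>T. card {X\<in>all_streams n t. transcript step init l t (\<Union>u\<in>S. hidden (J u)) (plant T x X) = \<tau>}"
  shows "c {} * c (A \<union> B) = c A * c B"
proof -
  define D where "D = (\<Union>u\<in>S. hidden (J u))"
  define U where "U = (\<Union>u\<in>B. J u)"
  define E where "E = (\<lambda>T. {X\<in>all_streams n t. tr (plant T x X) = \<tau>})"
  have BU: "B \<subseteq> U" using mem AB unfolding U_def by blast
  have AU: "A \<inter> U = {}"
  proof -
    have False if "a \<in> A" "b \<in> B" "a \<in> J b" for a b
      using that mem[of a] disj[of a b] AB by blast
    then show ?thesis by (auto simp: U_def)
  qed
  have D0: "0 \<notin> D" by (auto simp: D_def hidden_def)
  \<comment> \<open>A hidden position and its predecessor lie in one common block, and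
    \<open>U\<close> contains a block entirely or not at all.\<close>
  have cut: "Suc i \<notin> D" if ne: "(Suc i \<in> U) \<noteq> (i \<in> U)" for i
  proof
    assume "Suc i \<in> D"
    then obtain u where u: "u \<in> S" "Suc i \<in> J u" "i \<in> J u" by (auto simp: D_def hidden_def)
    have "k \<in> U \<longleftrightarrow> u \<in> B" if "k \<in> J u" for k
      using that u disj[of u] AB by (auto simp: U_def)
    then show False using ne u by blast
  qed
  have mix_tr: "tr (mix U X Y) = \<tau>" if "tr X = \<tau>" "tr Y = \<tau>" for X Y
  proof -
    have "transcript step init l t D (mix U X Y) = transcript step init l t D X"
      by (rule transcript_mix[OF t D0 cut]) (use that in \<open>auto simp: tr_def D_def\<close>)
    then show ?thesis using that by (simp add: tr_def D_def)
  qed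
  \<comment> \<open>Planting is compatible with the exchange since \<open>B\<close> lies inside
    \<open>U\<close> and \<open>A\<close> outside. In \<open>p3\<close> the exchange discards
    exactly the planted symbols.\<close>
  have p1: "plant B x (mix U X Y) = mix U X (plant (A \<union> B) x Y)"
    and p2: "plant A x (mix U Y X) = mix U (plant (A \<union> B) x Y) X"
    and p3: "mix U X Y = mix U (plant B x X) (plant A x Y)"
    and p4: "plant (A \<union> B) x (mix U Y X) = mix U (plant A x Y) (plant B x X)" for X Y
    using AU BU by (auto simp: plant_def mix_def fun_eq_iff)
  let ?f = "\<lambda>(X, Y). (mix U X Y, mix U Y X)"
  have "bij_betw ?f (E {} \<times> E (A \<union> B)) (E B \<times> E A)"
  proof (rule bij_betw_byWitness[where f' = ?f])
    show "?f ` (E {} \<times> E (A \<union> B)) \<subseteq> E B \<times> E A"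
      using mix_tr by (auto simp: E_def mix_in_streams p1 p2)
    show "?f ` (E B \<times> E A) \<subseteq> E {} \<times> E (A \<union> B)"
    proof -
      have "tr (mix U X Y) = \<tau>" if "tr (plant B x X) = \<tau>" "tr (plant A x Y) = \<tau>" for X Y
        using mix_tr[OF that] by (subst p3)
      then show ?thesis using mix_tr by (auto simp: E_def mix_in_streams p4)
    qed
  qed auto
  then have "card (E {} \<times> E (A \<union> B)) = card (E B \<times> E A)" by (rule bij_betw_same_card)
  then show ?thesis unfolding c_def tr_def E_def by (simp add: card_cartesian_product mult.commute)
qed

text \<open>The merging inequality for the transcript laws \<open>P A\<close> of streams with the
  needle planted at \<open>A\<close>; cut-and-paste supplies the product property it
  requires.\<close>

lemma transcript_loss_le_sum:
  fixes J :: "nat \<Rightarrow> nat set" and step init l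
  assumes t: "t > 0" and n: "n > 0" and x: "x < n" and S: "S \<subseteq> {..<t}"
    and mem: "\<And>u. u \<in> S \<Longrightarrow> u \<in> J u"
    and disj: "\<And>u v. u \<in> S \<Longrightarrow> v \<in> S \<Longrightarrow> u \<noteq> v \<Longrightarrow> J u \<inter> J v = {}"
  defines "tr \<equiv> transcript step init l t (\<Union>u\<in>S. hidden (J u))"
  shows "1 - bhatt (all_streams n t) tr (\<lambda>X. tr (plant S x X))
    \<le> exp 2 * (\<Sum>u\<in>S. 1 - bhatt (all_streams n t) tr (\<lambda>X. tr (plant {u} x X)))"
proof -
  define \<Omega> where "\<Omega> = all_streams n t"
  define N where "N = real (card \<Omega>)"
  have N: "N > 0" using n by (simp add: N_def \<Omega>_def card_all_streams)
  define c where "c = (\<lambda>A \<tau>. card {X\<in>\<Omega>. tr (plant A x X) = \<tau>})"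
  define P where "P = (\<lambda>A \<tau>. real (c A \<tau>) / N)"
  define T where "T = tr ` \<Omega>"
  define eps where "eps = (\<lambda>A. 1 - (\<Sum>\<tau>\<in>T. sqrt (P {} \<tau> * P A \<tau>)))"
  have T: "finite T" by (simp add: T_def \<Omega>_def)
  have sub: "(\<lambda>X. tr (plant A x X)) ` \<Omega> \<subseteq> T" if "A \<subseteq> S" for A
    using plant_in_streams[of _ n t A x] that S x by (auto simp: T_def \<Omega>_def)
  have eps_eq: "eps A = 1 - bhatt \<Omega> tr (\<lambda>X. tr (plant A x X))" if "A \<subseteq> S" for A
  proof -
    have "bhatt \<Omega> tr (\<lambda>X. tr (plant A x X)) = (\<Sum>\<tau>\<in>T. sqrt (real (c {} \<tau>) * real (c A \<tau>))) / N"
      unfolding c_def plant_empty N_def using sub[OF that] by (intro bhatt_superset[OF T]) (auto simp: T_def)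
    also have "\<dots> = (\<Sum>\<tau>\<in>T. sqrt (P {} \<tau> * P A \<tau>))"
      using N by (simp add: P_def sum_divide_distrib real_sqrt_divide)
    finally show ?thesis by (simp add: eps_def)
  qed
  have "eps S \<le> exp 2 * (\<Sum>u\<in>S. eps {u})"
  proof (rule eps_le_sum_singletons[where P = P and T = T and S = S])
    show "P A \<tau> \<ge> 0" for A \<tau> using N by (simp add: P_def)
    show "(\<Sum>\<tau>\<in>T. P A \<tau>) = 1" if "A \<subseteq> S" for A
    proof -
      have "(\<Sum>\<tau>\<in>T. real (c A \<tau>)) = N"
        using sum_card_fibres[of \<Omega> T "\<lambda>X. tr (plant A x X)" "\<lambda>_. True"] sub[OF that] T
        by (simp add: c_def N_def \<Omega>_def)
      then show ?thesis using N by (simp add: P_def flip: sum_divide_distrib)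
    qed
    show "P {} \<tau> * P (A \<union> B) \<tau> = P A \<tau> * P B \<tau>" if "A \<subseteq> S" "B \<subseteq> S" "A \<inter> B = {}" for A B \<tau>
    proof -
      have "c {} \<tau> * c (A \<union> B) \<tau> = c A \<tau> * c B \<tau>"
        unfolding c_def \<Omega>_def tr_def by (rule transcript_cut_and_paste[OF t that(3,1,2) mem disj]) auto
      then have "real (c {} \<tau>) * real (c (A \<union> B) \<tau>) = real (c A \<tau>) * real (c B \<tau>)"
        by (metis of_nat_mult)
      then show ?thesis by (simp add: P_def)
    qed
    show "finite S" using S finite_subset by blast
  qed (use T in \<open>auto simp: eps_def\<close>)
  then show ?thesis using eps_eq by (simp add: \<Omega>_def)
qed

text \<open>Given the stream outside the interval, its influence on the run is carried by one state per
  pass, that is, by \<open>l * s\<close> bits.\<close>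

definition exit_states ::
  "(nat \<Rightarrow> nat \<Rightarrow> nat \<Rightarrow> nat \<Rightarrow> nat) \<Rightarrow> nat \<Rightarrow> nat \<Rightarrow> nat \<Rightarrow> nat \<Rightarrow> nat \<Rightarrow> (nat \<Rightarrow> nat)
     \<Rightarrow> (nat \<Rightarrow> nat) \<times> (nat \<Rightarrow> nat)" where
  "exit_states step init l t a e X =
     (\<lambda>i. if i \<in> {a..<e} then 0 else X i,
      restrict (\<lambda>j. state_at step init t X (j * t + e)) {..<l})"

lemma exit_states_eqD:
  assumes "exit_states step init l t a e X = exit_states step init l t a e Y"
  shows "i \<notin> {a..<e} \<Longrightarrow> X i = Y i"
    and "j < l \<Longrightarrow> state_at step init t X (j * t + e) = state_at step init t Y (j * t + e)"
proof -
  have 1: "(\<lambda>i. if i \<in> {a..<e} then 0 else X i) = (\<lambda>i. if i \<in> {a..<e} then 0 else Y i)"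
    and 2: "restrict (\<lambda>j. state_at step init t X (j * t + e)) {..<l}
      = restrict (\<lambda>j. state_at step init t Y (j * t + e)) {..<l}"
    using assms by (simp_all only: exit_states_def prod.inject)
  show "i \<notin> {a..<e} \<Longrightarrow> X i = Y i" using fun_cong[OF 1, of i] by (simp only: if_False)
  show "j < l \<Longrightarrow> state_at step init t X (j * t + e) = state_at step init t Y (j * t + e)"
    using fun_cong[OF 2, of j] by (simp only: restrict_apply' lessThan_iff)
qed

text \<open>Outside the interval both runs read the same symbols. Inside it no state after the entry
  is published, and the state on leaving is part of the data, so the runs agree again from there
  on.\<close>

lemma exit_states_determine_transcript:
  assumes t: "t > 0" and ae: "a < e" "e \<le> t"
    and D: "hidden {a..<e} \<subseteq> D"
    and eq: "exit_states step init l t a e X = exit_states step init l t a e Y"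
  shows "transcript step init l t D X = transcript step init l t D Y"
proof -
  let ?s = "state_at step init t"
  have out: "X i = Y i" if "i \<notin> {a..<e}" for i
    using exit_states_eqD(1)[OF eq that] .
  have ex: "?s X (j * t + e) = ?s Y (j * t + e)" if "j < l" for j
    using exit_states_eqD(2)[OF eq that] .
  have "m mod t \<notin> hidden {a..<e} \<longrightarrow> ?s X m = ?s Y m" if "m \<le> l * t" for m
    using that
  proof (induction m)
    case (Suc m)
    show ?case
    proof
      assume ni: "Suc m mod t \<notin> hidden {a..<e}"
      show "?s X (Suc m) = ?s Y (Suc m)"
      proof (cases "m mod t \<in> {a..<e}")
        case True
        \<comment> \<open>The comparison is with \<open>Suc (m mod t)\<close> rather than
          \<open>Suc m mod t\<close>, so that \<open>e = t\<close> is covered, where the exit falls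
          at the start of the next pass.\<close>
        have "Suc (m mod t) = e"
        proof (rule ccontr)
          assume "Suc (m mod t) \<noteq> e"
          then have lt: "Suc (m mod t) < e" using True by auto
          then have "Suc m mod t = Suc (m mod t)" using ae t by (intro Suc_mod_less) auto
          then show False using ni True lt by (auto simp: hidden_def)
        qed
        then have "Suc m = (m div t) * t + e"
          by (metis add_Suc_right div_mult_mod_eq)
        moreover have "m div t < l" using Suc.prems t by (simp add: less_mult_imp_div_less)
        ultimately show ?thesis using ex by metis
      next
        case False
        then have "m mod t \<notin> hidden {a..<e}" by (auto simp: hidden_def)
        then show ?thesis using Suc out[OF False] by simp
      qed
    qed
  qed simp
  then show ?thesis using D by (auto simp: transcript_def fun_eq_iff)
qed

lemma card_exit_states_range:
  assumes ae: "a < e" "e \<le> t"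
    and st: "init < 2 ^ s" "\<And>j i st x. step j i st x < 2 ^ s"
  shows "card (exit_states step init l t a e ` all_streams n t) \<le> (2 ^ s) ^ l * n ^ (t - card {a..<e})"
proof -
  let ?K = "PiE_dflt ({..<t} - {a..<e}) 0 (\<lambda>_. {..<n}) \<times> PiE {..<l} (\<lambda>_. {..<(2::nat) ^ s})"
  have s: "state_at step init t X m < 2 ^ s" for X m
    by (cases m) (auto simp: st)
  have "exit_states step init l t a e ` all_streams n t \<subseteq> ?K"
    using s by (auto simp: exit_states_def PiE_dflt_def all_streams_iff split: if_splits)
  moreover have "finite ?K" by (intro finite_cartesian_product finite_PiE finite_PiE_dflt) auto
  ultimately have "card (exit_states step init l t a e ` all_streams n t) \<le> card ?K"
    by (rule card_mono[rotated])
  also have "card ({..<t} - {a..<e}) = t - card {a..<e}"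
    using ae by (subst card_Diff_subset) auto
  then have "card ?K = (2 ^ s) ^ l * n ^ (t - card {a..<e})"
    by (simp add: card_cartesian_product card_PiE_dflt card_PiE)
  finally show ?thesis .
qed

text \<open>Loss caused by a single symbol planted at \<open>u\<close>, averaged over the needle,
  for an observer who sees everything except the inside of the interval.\<close>

definition exit_loss where
  "exit_loss step init l t n a e u =
    (\<Sum>x<n. 1 - bhatt (all_streams n t) (exit_states step init l t a e)
        (\<lambda>X. exit_states step init l t a e (plant {u} x X))) / real n"

lemma sum_exit_loss_le:
  assumes n: "n > 0" and ae: "a < e" "e \<le> t"
    and st: "init < 2 ^ s" "\<And>j i st x. step j i st x < 2 ^ s"
  shows "(\<Sum>u\<in>{a..<e}. exit_loss step init l t n a e u) \<le> real l * real s"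
proof -
  have "(\<Sum>u\<in>{a..<e}. exit_loss step init l t n a e u) \<le> ln (real ((2 ^ s) ^ l)) / 2"
    unfolding exit_loss_def
  proof (rule sum_hellinger_le_log_card_range[OF n])
    show "card (exit_states step init l t a e ` all_streams n t) \<le> (2 ^ s) ^ l * n ^ (t - card {a..<e})"
      by (rule card_exit_states_range[OF ae st])
    fix X Y u
    assume eq: "exit_states step init l t a e X = exit_states step init l t a e Y" and u: "u \<notin> {a..<e}"
    show "X u = Y u" using exit_states_eqD(1)[OF eq u] .
  qed (use ae in auto)
  also have "ln (real ((2 ^ s) ^ l)) = real l * real s * ln 2"
    by (simp add: ln_realpow)
  also have "real l * real s * ln 2 / 2 \<le> real l * real s"
  proof -
    have "real l * real s * (ln 2 / 2) \<le> real l * real s * 1"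
      using ln_2_less_1 by (intro mult_left_mono) auto
    then show ?thesis by simp
  qed
  finally show ?thesis .
qed

subsection \<open>Dyadic blocks\<close>

text \<open>The exponent of the largest dyadic block around \<open>u\<close> that isolates it from
  the rest of \<open>S\<close>, capped at \<open>K\<close>. The set is never empty: blocks of length
  1 always qualify.\<close>

definition level :: "nat \<Rightarrow> nat set \<Rightarrow> nat \<Rightarrow> nat" where
  "level K S u = Max {k. k \<le> K \<and> (\<forall>v\<in>S. v div 2 ^ k = u div 2 ^ k \<longrightarrow> v = u)}"

lemma
  shows level_le: "level K S u \<le> K"
    and level_isolated: "\<And>v. v \<in> S \<Longrightarrow> v div 2 ^ level K S u = u div 2 ^ level K S u \<Longrightarrow> v = u"
    and level_maximal: "level K S u < k \<Longrightarrow> k \<le> K \<Longrightarrow> \<exists>v\<in>S. v div 2 ^ k = u div 2 ^ k \<and> v \<noteq> u"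
proof -
  let ?L = "{k. k \<le> K \<and> (\<forall>v\<in>S. v div 2 ^ k = u div 2 ^ k \<longrightarrow> v = u)}"
  have fin: "finite ?L" by simp
  have "0 \<in> ?L" by simp
  then have "level K S u \<in> ?L" unfolding level_def using Max_in[OF fin] by blast
  then show "level K S u \<le> K"
    and "\<And>v. v \<in> S \<Longrightarrow> v div 2 ^ level K S u = u div 2 ^ level K S u \<Longrightarrow> v = u" by auto
  show "\<exists>v\<in>S. v div 2 ^ k = u div 2 ^ k \<and> v \<noteq> u" if "level K S u < k" "k \<le> K"
  proof (rule ccontr)
    assume "\<not> ?thesis"
    then have "k \<in> ?L" using that by auto
    then have "k \<le> level K S u" unfolding level_def by (rule Max_ge[OF fin])
    then show False using that by simp
  qed
qed

text \<open>Cut off at \<open>t\<close>, since \<open>t\<close> need not be a multiple of the block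
  length.\<close>

definition block :: "nat \<Rightarrow> nat \<Rightarrow> nat \<Rightarrow> nat set" where
  "block t k q = {q * 2 ^ k..<min (Suc q * 2 ^ k) t}"

lemma mem_block_iff: "i \<in> block t k q \<longleftrightarrow> i < t \<and> i div 2 ^ k = q"
proof -
  have "i div 2 ^ k = q \<longleftrightarrow> q * 2 ^ k \<le> i \<and> i < Suc q * 2 ^ k"
    by (metis div_nat_eqI dividend_less_div_times div_times_less_eq_dividend mult.commute
        mult_Suc zero_less_numeral zero_less_power add.commute)
  then show ?thesis by (auto simp: block_def)
qed

text \<open>Dyadic blocks are nested or disjoint. If the two met, the larger would contain both
  \<open>u\<close> and \<open>v\<close>, contradicting the isolation of its own needle
  position.\<close>

lemma disjoint_dyadic_blocks:
  assumes "level K S u = k" "level K S v = k'" "u \<in> S" "v \<in> S" "u \<noteq> v"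
  shows "block t k (u div 2 ^ k) \<inter> block t k' (v div 2 ^ k') = {}"
proof -
  have coarser: "a div 2 ^ j' = b div 2 ^ j'" if "a div 2 ^ j = b div 2 ^ j" "j \<le> j'" for a b j j' :: nat
  proof -
    have "(2::nat) ^ j' = 2 ^ j * 2 ^ (j' - j)" using that by (simp flip: power_add)
    then show ?thesis using that by (simp add: div_mult2_eq)
  qed
  have False if i: "i div 2 ^ k = u div 2 ^ k" "i div 2 ^ k' = v div 2 ^ k'" for i
  proof (cases "k \<le> k'")
    case True
    then have "u div 2 ^ k' = v div 2 ^ k'" using coarser[OF i(1)] i(2) by simp
    then show False using level_isolated[of u S K v] assms by auto
  next
    case False
    then have "v div 2 ^ k = u div 2 ^ k" using coarser[OF i(2), of k] i(1) by simp
    then show False using level_isolated[of v S K u] assms by auto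
  qed
  then show ?thesis by (auto simp: mem_block_iff)
qed

section \<open>Losses of a fixed deterministic algorithm\<close>

context
  fixes step :: "nat \<Rightarrow> nat \<Rightarrow> nat \<Rightarrow> nat \<Rightarrow> nat" and init l t n s :: nat
  assumes t: "t > 0" and n: "n > 0"
    and init_bound: "init < 2 ^ s" and step_bound: "\<And>j i st x. step j i st x < 2 ^ s"
begin

definition loss :: "nat \<Rightarrow> nat \<Rightarrow> real" where
  "loss k u = exit_loss step init l t n (u div 2 ^ k * 2 ^ k) (min (Suc (u div 2 ^ k) * 2 ^ k) t) u"

lemma loss_nonneg: "loss k u \<ge> 0"
  unfolding loss_def exit_loss_def
  by (intro divide_nonneg_nonneg sum_nonneg) (auto simp: bhatt_le_1)

text \<open>Positions are grouped by their block of length \<open>2 ^ k\<close>; each block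
  contributes at most \<open>l * s\<close>, and the first factor counts the blocks.\<close>

lemma sum_loss_le: "(\<Sum>u<t. loss k u) \<le> real (Suc ((t - 1) div 2 ^ k)) * (real l * real s)"
proof -
  have "(\<Sum>u<t. loss k u) = (\<Sum>q\<in>{..(t - 1) div 2 ^ k}. \<Sum>u\<in>{u\<in>{..<t}. u div 2 ^ k = q}. loss k u)"
    by (rule sum.group[symmetric]) (auto intro!: div_le_mono)
  also have "\<dots> \<le> (\<Sum>q\<in>{..(t - 1) div 2 ^ k}. real l * real s)"
  proof (rule sum_mono)
    fix q assume "q \<in> {..(t - 1) div 2 ^ k}"
    then have "q * 2 ^ k \<le> t - 1" by (simp add: less_eq_div_iff_mult_less_eq)
    then have lt: "q * 2 ^ k < min (Suc q * 2 ^ k) t" using t by auto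
    have "{u\<in>{..<t}. u div 2 ^ k = q} = block t k q" by (auto simp: mem_block_iff)
    then have "(\<Sum>u\<in>{u\<in>{..<t}. u div 2 ^ k = q}. loss k u)
       = (\<Sum>u\<in>block t k q. exit_loss step init l t n (q * 2 ^ k) (min (Suc q * 2 ^ k) t) u)"
      by (auto intro!: sum.cong simp: loss_def mem_block_iff)
    also have "\<dots> \<le> real l * real s"
      unfolding block_def using lt by (intro sum_exit_loss_le n init_bound step_bound) auto
    finally show "(\<Sum>u\<in>{u\<in>{..<t}. u div 2 ^ k = q}. loss k u) \<le> real l * real s" .
  qed
  also have "\<dots> = real (Suc ((t - 1) div 2 ^ k)) * (real l * real s)" by simp
  finally show ?thesis .
qed

text \<open>Passing from the output to the transcript only increases the loss, merging then reduces
  \<open>S\<close> to single positions, and for each \<open>u\<close> separately the transcript is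
  replaced by the finer data \<open>ex u\<close> of its own block.\<close>

lemma acceptance_loss_le:
  fixes out :: "nat \<Rightarrow> bool"
  defines "acc \<equiv> \<lambda>X. out (state_at step init t X (l * t))"
  assumes S: "S \<subseteq> {..<t}"
  shows "(\<Sum>x<n. 1 - bhatt (all_streams n t) acc (\<lambda>X. acc (plant S x X))) / real n
     \<le> exp 2 * (\<Sum>u\<in>S. loss (level K S u) u)"
proof -
  define J where "J = (\<lambda>u. block t (level K S u) (u div 2 ^ level K S u))"
  define tr where "tr = transcript step init l t (\<Union>u\<in>S. hidden (J u))"
  define ex where "ex = (\<lambda>u. exit_states step init l t (u div 2 ^ level K S u * 2 ^ level K S u)
      (min (Suc (u div 2 ^ level K S u) * 2 ^ level K S u) t))"
  have acc_tr: "acc X = acc Y" if "tr X = tr Y" for X Y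
  proof -
    \<comment> \<open>The final time is a multiple of \<open>t\<close>, and position 0 is never
      hidden, so the transcript contains the final state.\<close>
    have "state_at step init t X (l * t) = state_at step init t Y (l * t)"
      by (rule transcript_eqD[OF that[unfolded tr_def]]) (auto simp: hidden_def)
    then show ?thesis by (simp add: acc_def)
  qed
  have tr_ex: "tr X = tr Y" if "u \<in> S" "ex u X = ex u Y" for u X Y
    unfolding tr_def
  proof (rule exit_states_determine_transcript[OF t _ _ _ that(2)[unfolded ex_def]])
    let ?k = "level K S u"
    have "u \<in> block t ?k (u div 2 ^ ?k)" using that S by (auto simp: mem_block_iff)
    then show "u div 2 ^ ?k * 2 ^ ?k < min (Suc (u div 2 ^ ?k) * 2 ^ ?k) t"
      unfolding block_def atLeastLessThan_iff by (meson le_less_trans)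
    show "hidden {u div 2 ^ ?k * 2 ^ ?k..<min (Suc (u div 2 ^ ?k) * 2 ^ ?k) t} \<subseteq> (\<Union>u\<in>S. hidden (J u))"
      using that by (auto simp: J_def block_def)
  qed simp
  have each: "1 - bhatt (all_streams n t) acc (\<lambda>X. acc (plant S x X))
      \<le> exp 2 * (\<Sum>u\<in>S. 1 - bhatt (all_streams n t) (ex u) (\<lambda>X. ex u (plant {u} x X)))"
    if x: "x < n" for x
  proof -
    have "1 - bhatt (all_streams n t) acc (\<lambda>X. acc (plant S x X))
       \<le> 1 - bhatt (all_streams n t) tr (\<lambda>X. tr (plant S x X))"
      by (intro diff_left_mono bhatt_refine finite_all_streams plant_in_streams S x) (rule acc_tr)
    also have "\<dots> \<le> exp 2 * (\<Sum>u\<in>S. 1 - bhatt (all_streams n t) tr (\<lambda>X. tr (plant {u} x X)))"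
      unfolding tr_def
    proof (rule transcript_loss_le_sum[OF t n x S])
      show "u \<in> J u" if "u \<in> S" for u using that S by (auto simp: J_def mem_block_iff)
      show "J u \<inter> J v = {}" if "u \<in> S" "v \<in> S" "u \<noteq> v" for u v
        unfolding J_def by (rule disjoint_dyadic_blocks[OF refl refl that])
    qed
    also have "\<dots> \<le> exp 2 * (\<Sum>u\<in>S. 1 - bhatt (all_streams n t) (ex u) (\<lambda>X. ex u (plant {u} x X)))"
    proof (intro mult_left_mono sum_mono diff_left_mono)
      fix u assume u: "u \<in> S"
      then have "{u} \<subseteq> {..<t}" using S by auto
      then show "bhatt (all_streams n t) (ex u) (\<lambda>X. ex u (plant {u} x X))
          \<le> bhatt (all_streams n t) tr (\<lambda>X. tr (plant {u} x X))"
        by (intro bhatt_refine finite_all_streams plant_in_streams x) (rule tr_ex[OF u])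
    qed simp
    finally show ?thesis .
  qed
  have "(\<Sum>x<n. 1 - bhatt (all_streams n t) acc (\<lambda>X. acc (plant S x X)))
     \<le> (\<Sum>x<n. exp 2 * (\<Sum>u\<in>S. 1 - bhatt (all_streams n t) (ex u) (\<lambda>X. ex u (plant {u} x X))))"
    using each by (intro sum_mono) auto
  also have "\<dots> = exp 2 * (\<Sum>u\<in>S. \<Sum>x<n. 1 - bhatt (all_streams n t) (ex u) (\<lambda>X. ex u (plant {u} x X)))"
    unfolding sum_distrib_left[symmetric] by (subst sum.swap) (rule refl)
  finally have "(\<Sum>x<n. 1 - bhatt (all_streams n t) acc (\<lambda>X. acc (plant S x X))) / real n
     \<le> exp 2 * (\<Sum>u\<in>S. \<Sum>x<n. 1 - bhatt (all_streams n t) (ex u) (\<lambda>X. ex u (plant {u} x X))) / real n"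
    by (rule divide_right_mono) simp
  also have "\<dots> = exp 2 * (\<Sum>u\<in>S. loss (level K S u) u)"
    by (simp only: loss_def exit_loss_def ex_def sum_divide_distrib times_divide_eq_right[symmetric])
  finally show ?thesis .
qed

end

subsection \<open>Random needle positions\<close>

definition needle_positions :: "nat \<Rightarrow> real \<Rightarrow> nat set pmf" where
  "needle_positions t p = map_pmf (\<lambda>B. {i. B i}) (Pi_pmf {0..<t} False (\<lambda>_. bernoulli_pmf p))"

lemma set_needle_positions: "set_pmf (needle_positions t p) \<subseteq> Pow {..<t}"
  using set_Pi_pmf_subset[of "{0..<t}" False "\<lambda>_. bernoulli_pmf p"]
  by (fastforce simp: needle_positions_def)

lemma finite_set_needle_positions: "finite (set_pmf (needle_positions t p))"
  by (rule finite_subset[OF set_needle_positions]) simp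

lemma prob_needle_positions_superset:
  assumes p: "0 \<le> p" "p \<le> 1" and T: "T \<subseteq> {..<t}"
  shows "measure_pmf.prob (needle_positions t p) {S. T \<subseteq> S} = p ^ card T"
proof -
  have "measure_pmf.prob (needle_positions t p) {S. T \<subseteq> S}
     = measure_pmf.prob (Pi_pmf {0..<t} False (\<lambda>_. bernoulli_pmf p)) (Pi {0..<t} (\<lambda>i. if i \<in> T then {True} else UNIV))"
    unfolding needle_positions_def measure_map_pmf
    by (rule arg_cong2[where f = measure]) (use T in \<open>auto simp: Pi_def subset_eq\<close>)
  also have "\<dots> = (\<Prod>i\<in>{0..<t}. if i \<in> T then p else 1)"
    unfolding measure_Pi_pmf_Pi[OF finite_atLeastLessThan]
    using p by (intro prod.cong refl) (auto simp: measure_pmf_single)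
  also have "\<dots> = (\<Prod>i\<in>T. p)"
    using T by (subst prod.inter_restrict[symmetric]) (auto intro!: prod.cong simp: lessThan_atLeast0 Int_absorb1)
  finally show ?thesis by simp
qed

text \<open>At level \<open>k < K\<close> the block of twice the length contains a second needle
  position; this is a union bound over the at most \<open>2 ^ Suc k\<close> candidates, each pair
  having probability \<open>p\<^sup>2\<close>.\<close>

lemma prob_level_le:
  assumes p: "0 \<le> p" "p \<le> 1" and u: "u < t" and k: "k < K"
  shows "measure_pmf.prob (needle_positions t p) {S. u \<in> S \<and> level K S u = k} \<le> p\<^sup>2 * 2 ^ Suc k"
proof -
  let ?M = "measure_pmf.prob (needle_positions t p)"
  define V where "V = block t (Suc k) (u div 2 ^ Suc k) - {u}"
  have V: "finite V" by (simp add: V_def block_def)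
  have cV: "card V \<le> 2 ^ Suc k"
  proof -
    have "card V \<le> card (block t (Suc k) (u div 2 ^ Suc k))" unfolding V_def by (rule card_Diff1_le)
    also have "\<dots> \<le> 2 ^ Suc k" by (simp add: block_def)
    finally show ?thesis .
  qed
  have "?M {S. u \<in> S \<and> level K S u = k} = ?M ({S. u \<in> S \<and> level K S u = k} \<inter> set_pmf (needle_positions t p))"
    by (simp add: measure_Int_set_pmf)
  also have "\<dots> \<le> ?M (\<Union>v\<in>V. {S. {u, v} \<subseteq> S})"
  proof (intro measure_pmf.finite_measure_mono subsetI)
    fix S assume S: "S \<in> {S. u \<in> S \<and> level K S u = k} \<inter> set_pmf (needle_positions t p)"
    then have "S \<subseteq> {..<t}" using set_needle_positions by blast
    moreover obtain v where "v \<in> S" "v div 2 ^ Suc k = u div 2 ^ Suc k" "v \<noteq> u"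
      using level_maximal[of K S u "Suc k"] S k by auto
    ultimately have "v \<in> V" "v \<in> S" by (auto simp: V_def mem_block_iff)
    then show "S \<in> (\<Union>v\<in>V. {S. {u, v} \<subseteq> S})" using S by auto
  qed simp
  also have "\<dots> \<le> (\<Sum>v\<in>V. ?M {S. {u, v} \<subseteq> S})"
    using V by (intro measure_pmf.finite_measure_subadditive_finite) auto
  also have "\<dots> = (\<Sum>v\<in>V. p\<^sup>2)"
  proof (intro sum.cong refl)
    fix v assume "v \<in> V"
    then have "{u, v} \<subseteq> {..<t}" "card {u, v} = 2" using u by (auto simp: V_def mem_block_iff)
    then show "?M {S. {u, v} \<subseteq> S} = p\<^sup>2" using prob_needle_positions_superset[OF p, of "{u, v}" t] by simp
  qed
  also have "\<dots> = real (card V) * p\<^sup>2" by simp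
  also have "\<dots> \<le> 2 ^ Suc k * p\<^sup>2"
    using cV by (intro mult_right_mono) (simp_all add: of_nat_le_iff[symmetric, where 'a=real] del: of_nat_le_iff)
  finally show ?thesis by (simp add: mult.commute)
qed

text \<open>Split according to the level of \<open>u\<close>. At the cap \<open>K\<close> no second
  position is guaranteed, so only the probability \<open>p\<close> of \<open>u \<in> S\<close> is
  available there.\<close>

lemma expected_level_cost_le:
  fixes c :: "nat \<Rightarrow> nat \<Rightarrow> real"
  assumes p: "0 \<le> p" "p \<le> 1" and c: "\<And>k u. c k u \<ge> 0"
  shows "measure_pmf.expectation (needle_positions t p) (\<lambda>S. \<Sum>u\<in>S. c (level K S u) u)
     \<le> p * (\<Sum>u<t. c K u) + (\<Sum>k<K. p\<^sup>2 * 2 ^ Suc k * (\<Sum>u<t. c k u))"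
proof -
  let ?W = "needle_positions t p"
  let ?ind = "\<lambda>k u. indicator {S. u \<in> S \<and> level K S u = k} :: nat set \<Rightarrow> real"
  have "measure_pmf.expectation ?W (\<lambda>S. \<Sum>u\<in>S. c (level K S u) u)
     = measure_pmf.expectation ?W (\<lambda>S. \<Sum>k\<le>K. \<Sum>u<t. ?ind k u S * c k u)"
  proof (rule integral_cong_AE)
    show "AE S in measure_pmf ?W. (\<Sum>u\<in>S. c (level K S u) u) = (\<Sum>k\<le>K. \<Sum>u<t. ?ind k u S * c k u)"
    proof (rule AE_pmfI)
      fix S assume "S \<in> set_pmf ?W"
      then have S: "S \<subseteq> {..<t}" using set_needle_positions by blast
      have "(\<Sum>k\<le>K. \<Sum>u<t. ?ind k u S * c k u) = (\<Sum>u<t. \<Sum>k\<le>K. if k = level K S u then (if u \<in> S then c k u else 0) else 0)"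
        by (subst sum.swap) (auto intro!: sum.cong simp: indicator_def)
      also have "\<dots> = (\<Sum>u<t. if u \<in> S then c (level K S u) u else 0)"
        by (intro sum.cong refl) (simp add: sum.delta level_le)
      also have "\<dots> = (\<Sum>u\<in>S. c (level K S u) u)"
        using S by (subst sum.inter_restrict[symmetric]) (auto intro!: sum.cong)
      finally show "(\<Sum>u\<in>S. c (level K S u) u) = (\<Sum>k\<le>K. \<Sum>u<t. ?ind k u S * c k u)" ..
    qed
  qed auto
  also have "\<dots> = (\<Sum>k\<le>K. \<Sum>u<t. measure_pmf.prob ?W {S. u \<in> S \<and> level K S u = k} * c k u)"
    by (simp only: Bochner_Integration.integral_sum integrable_measure_pmf_finite[OF finite_set_needle_positions]
        integral_mult_left_zero Bochner_Integration.integral_indicator space_measure_pmf Int_UNIV_right)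
  also have "\<dots> = (\<Sum>u<t. measure_pmf.prob ?W {S. u \<in> S \<and> level K S u = K} * c K u)
     + (\<Sum>k<K. \<Sum>u<t. measure_pmf.prob ?W {S. u \<in> S \<and> level K S u = k} * c k u)"
    by (simp add: lessThan_Suc_atMost[symmetric])
  also have "\<dots> \<le> (\<Sum>u<t. p * c K u) + (\<Sum>k<K. \<Sum>u<t. p\<^sup>2 * 2 ^ Suc k * c k u)"
  proof (intro add_mono sum_mono mult_right_mono c prob_level_le p)
    fix u assume "u \<in> {..<t}"
    have "measure_pmf.prob ?W {S. u \<in> S \<and> level K S u = K} \<le> measure_pmf.prob ?W {S. {u} \<subseteq> S}"
      by (intro measure_pmf.finite_measure_mono) auto
    also have "\<dots> = p" using prob_needle_positions_superset[OF p, of "{u}" t] \<open>u \<in> {..<t}\<close> by simp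
    finally show "measure_pmf.prob ?W {S. u \<in> S \<and> level K S u = K} \<le> p" .
  qed auto
  finally show ?thesis by (simp add: sum_distrib_left)
qed

section \<open>The planted distribution as an overwritten uniform stream\<close>

lemma uniform_stream_eq: "n > 0 \<Longrightarrow> uniform_stream n t = pmf_of_set (all_streams n t)"
  unfolding uniform_stream_def all_streams_def by (rule Pi_pmf_of_set) auto

text \<open>All coins are tossed first. A uniform symbol is then drawn at every position, also at
  those where it is overwritten, and the independent choices of coins and needle are
  interchanged.\<close>

lemma planted_stream_eq:
  assumes n: "n > 0"
  shows "planted_stream n t p = bind_pmf (needle_positions t p) (\<lambda>S.
     bind_pmf (pmf_of_set {0..<n}) (\<lambda>x. map_pmf (plant S x) (uniform_stream n t)))"
proof -
  let ?B = "Pi_pmf {0..<t} False (\<lambda>_. bernoulli_pmf p)"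
  have "Pi_pmf {0..<t} 0 (\<lambda>_. bind_pmf (bernoulli_pmf p) (\<lambda>b. if b then return_pmf x else pmf_of_set {0..<n}))
     = bind_pmf ?B (\<lambda>B. map_pmf (plant {i. B i} x) (uniform_stream n t))" for x :: nat
  proof -
    have "Pi_pmf {0..<t} 0 (\<lambda>_. bind_pmf (bernoulli_pmf p) (\<lambda>b. if b then return_pmf x else pmf_of_set {0..<n}))
      = bind_pmf ?B (\<lambda>B. Pi_pmf {0..<t} 0 (\<lambda>i. if B i then return_pmf x else pmf_of_set {0..<n}))"
      by (rule Pi_pmf_bind) simp
    also have "\<dots> = bind_pmf ?B (\<lambda>B. map_pmf (plant {i. B i} x) (uniform_stream n t))"
    proof (rule bind_pmf_cong[OF refl])
      fix B assume "B \<in> set_pmf ?B"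
      then have B: "\<not> B i" if "\<not> i < t" for i
        using set_Pi_pmf_subset[of "{0..<t}" False "\<lambda>_. bernoulli_pmf p"] that by auto
      have "Pi_pmf {0..<t} 0 (\<lambda>i. if B i then return_pmf x else pmf_of_set {0..<n})
        = Pi_pmf {0..<t} 0 (\<lambda>i. bind_pmf (pmf_of_set {0..<n}) (\<lambda>y. return_pmf (if B i then x else y)))"
        by (intro arg_cong[where f = "Pi_pmf {0..<t} 0"]) (auto simp: fun_eq_iff bind_return_pmf')
      also have "\<dots> = bind_pmf (uniform_stream n t) (\<lambda>X. return_pmf (\<lambda>i. if i \<in> {0..<t} then if B i then x else X i else 0))"
        unfolding uniform_stream_def by (subst Pi_pmf_bind[where d' = 0]) auto
      also have "\<dots> = bind_pmf (uniform_stream n t) (\<lambda>X. return_pmf (plant {i. B i} x X))"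
      proof (rule bind_pmf_cong[OF refl])
        fix X assume "X \<in> set_pmf (uniform_stream n t)"
        then have "X \<in> all_streams n t"
          using n unfolding uniform_stream_eq[OF n]
          by (subst (asm) set_pmf_of_set) (auto simp: all_streams_def)
        then show "return_pmf (\<lambda>i. if i \<in> {0..<t} then if B i then x else X i else 0) = return_pmf (plant {i. B i} x X)"
          using B by (auto simp: plant_def fun_eq_iff all_streams_iff)
      qed
      finally show "Pi_pmf {0..<t} 0 (\<lambda>i. if B i then return_pmf x else pmf_of_set {0..<n})
        = map_pmf (plant {i. B i} x) (uniform_stream n t)" by (simp add: map_pmf_def)
    qed
    finally show ?thesis .
  qed
  then have "planted_stream n t p = bind_pmf (pmf_of_set {0..<n}) (\<lambda>x.
       bind_pmf ?B (\<lambda>B. map_pmf (plant {i. B i} x) (uniform_stream n t)))"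
    unfolding planted_stream_def by simp
  also have "\<dots> = bind_pmf ?B (\<lambda>B. bind_pmf (pmf_of_set {0..<n}) (\<lambda>x. map_pmf (plant {i. B i} x) (uniform_stream n t)))"
    by (rule bind_commute_pmf)
  finally show ?thesis by (simp add: needle_positions_def bind_map_pmf)
qed

subsection \<open>The lower bound\<close>

lemma dyadic_scale:
  assumes t: "t \<ge> 2"
  obtains K where "t \<le> 2 ^ K" "\<And>k. k < K \<Longrightarrow> 2 ^ k < t" "real K \<le> log 2 (real t) + 1"
proof -
  define K where "K = (LEAST K. t \<le> 2 ^ K)"
  have K: "t \<le> 2 ^ K" unfolding K_def by (rule LeastI[of _ t]) (simp add: less_imp_le)
  have lt: "2 ^ k < t" if "k < K" for k using not_less_Least[OF that[unfolded K_def]] by simp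
  have "K > 0" using K t by (cases K) auto
  then have "2 ^ (K - 1) < t" by (intro lt) simp
  then have "(2::real) ^ (K - 1) \<le> real t" by (metis less_imp_le of_nat_le_iff of_nat_numeral of_nat_power)
  then have "real (K - 1) \<le> log 2 (real t)" using t by (subst le_log_iff) (simp_all add: powr_realpow)
  then show thesis using that[of K] K lt \<open>K > 0\<close> by (simp add: of_nat_diff)
qed

text \<open>Each scale below \<open>K\<close> costs at most \<open>4 * p\<^sup>2 * t * l * s\<close>
  and the top scale at most \<open>p\<^sup>2 * t * l * s\<close>. There are at most
  \<open>log 2 t + 1\<close> lower scales.\<close>

lemma expected_acceptance_loss_le:
  fixes out :: "nat \<Rightarrow> bool" and p :: real and step init l
  assumes t: "t \<ge> 2" and n: "n > 0" and p: "1 / real t \<le> p" "p \<le> 1"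
    and st: "init < 2 ^ s" "\<And>j i st x. step j i st x < 2 ^ s"
  defines "acc \<equiv> \<lambda>X. out (state_at step init t X (l * t))"
  shows "measure_pmf.expectation (needle_positions t p)
      (\<lambda>S. (\<Sum>x<n. 1 - bhatt (all_streams n t) acc (\<lambda>X. acc (plant S x X))) / real n)
    \<le> 9 * exp 2 * (real l * p\<^sup>2 * real s * real t * log 2 (real t))"
proof -
  let ?W = "needle_positions t p"
  let ?L = "log 2 (real t)"
  obtain K where K: "t \<le> 2 ^ K" "\<And>k. k < K \<Longrightarrow> 2 ^ k < t" "real K \<le> ?L + 1"
    using dyadic_scale[OF t] by blast
  have t0: "t > 0" using t by simp
  have p0: "0 \<le> p" using p(1) by (rule order_trans[rotated]) simp
  have L: "?L \<ge> 1" using t by (subst le_log_iff) auto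
  define ls where "ls = real l * real s"
  define c where "c = loss step init l t n"
  have ls: "ls \<ge> 0" by (simp add: ls_def)
  have sum_c: "(\<Sum>u<t. c k u) \<le> real (Suc ((t - 1) div 2 ^ k)) * ls" for k
    unfolding c_def ls_def by (rule sum_loss_le[OF t0 n st])
  have int: "integrable (measure_pmf ?W) f" for f :: "nat set \<Rightarrow> real"
    by (rule integrable_measure_pmf_finite[OF finite_set_needle_positions])
  have "measure_pmf.expectation ?W
      (\<lambda>S. (\<Sum>x<n. 1 - bhatt (all_streams n t) acc (\<lambda>X. acc (plant S x X))) / real n)
    \<le> measure_pmf.expectation ?W (\<lambda>S. exp 2 * (\<Sum>u\<in>S. c (level K S u) u))"
  proof (rule integral_mono_AE[OF int int], rule AE_pmfI)
    fix S assume "S \<in> set_pmf ?W"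
    then have "S \<subseteq> {..<t}" using set_needle_positions by blast
    then show "(\<Sum>x<n. 1 - bhatt (all_streams n t) acc (\<lambda>X. acc (plant S x X))) / real n
        \<le> exp 2 * (\<Sum>u\<in>S. c (level K S u) u)"
      unfolding acc_def c_def by (rule acceptance_loss_le[OF t0 n st])
  qed
  also have "\<dots> = exp 2 * measure_pmf.expectation ?W (\<lambda>S. \<Sum>u\<in>S. c (level K S u) u)" by simp
  also have "\<dots> \<le> exp 2 * (p * (\<Sum>u<t. c K u) + (\<Sum>k<K. p\<^sup>2 * 2 ^ Suc k * (\<Sum>u<t. c k u)))"
    unfolding c_def using p0 p(2) loss_nonneg[OF t0 n st]
    by (intro mult_left_mono expected_level_cost_le) auto
  also have "\<dots> \<le> exp 2 * (p\<^sup>2 * real t * ls + (\<Sum>k<K. 4 * p\<^sup>2 * real t * ls))"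
  proof (intro mult_left_mono add_mono sum_mono)
    \<comment> \<open>At the top scale a single block covers the stream. The factor \<open>p\<close>
      becomes \<open>p\<^sup>2 * t\<close> because \<open>p * t \<ge> 1\<close>.\<close>
    have "t - 1 < 2 ^ K" using K(1) t by linarith
    then have "(\<Sum>u<t. c K u) \<le> ls" using sum_c[of K] by simp
    then have "p * (\<Sum>u<t. c K u) \<le> p * ls" using p0 by (rule mult_left_mono)
    also have "p * 1 \<le> p * (p * real t)"
      using p p0 t by (intro mult_left_mono) (auto simp: field_simps)
    then have "p * ls \<le> p\<^sup>2 * real t * ls"
      using ls by (intro mult_right_mono) (auto simp: power2_eq_square)
    finally show "p * (\<Sum>u<t. c K u) \<le> p\<^sup>2 * real t * ls" .
  next
    fix k assume "k \<in> {..<K}"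
    then have k: "2 ^ k < t" using K(2) by simp
    \<comment> \<open>Blocks of length \<open>2 ^ k < t\<close>: the last, possibly incomplete one
      adds less than another \<open>t\<close> to the total length.\<close>
    have "2 ^ k * Suc ((t - 1) div 2 ^ k) \<le> 2 * t"
    proof -
      have "2 ^ k * ((t - 1) div 2 ^ k) \<le> t - 1" by simp
      then show ?thesis unfolding mult_Suc_right using k by linarith
    qed
    then have b: "2 ^ k * real (Suc ((t - 1) div 2 ^ k)) \<le> 2 * real t"
      by (simp only: of_nat_le_iff[symmetric, where 'a=real] of_nat_mult of_nat_power of_nat_numeral)
    have "2 ^ Suc k * (\<Sum>u<t. c k u) \<le> 2 ^ Suc k * (real (Suc ((t - 1) div 2 ^ k)) * ls)"
      by (intro mult_left_mono sum_c) simp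
    also have "\<dots> = 2 * ((2 ^ k * real (Suc ((t - 1) div 2 ^ k))) * ls)" by simp
    also have "\<dots> \<le> 2 * ((2 * real t) * ls)"
      using b ls by (intro mult_left_mono mult_right_mono) auto
    finally have "p\<^sup>2 * (2 ^ Suc k * (\<Sum>u<t. c k u)) \<le> p\<^sup>2 * (2 * ((2 * real t) * ls))"
      by (rule mult_left_mono) simp
    then show "p\<^sup>2 * 2 ^ Suc k * (\<Sum>u<t. c k u) \<le> 4 * p\<^sup>2 * real t * ls" by (simp add: mult_ac)
  qed simp
  also have "\<dots> = exp 2 * (p\<^sup>2 * real t * ls) * (4 * real K + 1)" by (simp add: algebra_simps)
  \<comment> \<open>\<open>4 * (?L + 1) + 1 \<le> 9 * ?L\<close>, as
    \<open>?L \<ge> 1\<close>.\<close>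
  also have "\<dots> \<le> exp 2 * (p\<^sup>2 * real t * ls) * (9 * ?L)"
    using K(3) L ls by (intro mult_left_mono mult_nonneg_nonneg) auto
  also have "\<dots> = 9 * exp 2 * (real l * p\<^sup>2 * real s * real t * ?L)" by (simp add: ls_def)
  finally show ?thesis .
qed

lemma pmf_accept_uniform:
  assumes n: "n > 0"
  shows "pmf (map_pmf Q (uniform_stream n t)) True = real (card {X\<in>all_streams n t. Q X}) / real (card (all_streams n t))"
proof -
  have ne: "all_streams n t \<noteq> {}" using n by (metis card.empty card_all_streams less_numeral_extra(3) zero_less_power)
  have "pmf (map_pmf Q (uniform_stream n t)) True = measure_pmf.prob (pmf_of_set (all_streams n t)) (Q -` {True})"
    unfolding uniform_stream_eq[OF n] by (rule pmf_map)
  also have "\<dots> = real (card (all_streams n t \<inter> Q -` {True})) / real (card (all_streams n t))"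
    by (rule measure_pmf_of_set[OF ne finite_all_streams])
  also have "all_streams n t \<inter> Q -` {True} = {X\<in>all_streams n t. Q X}" by auto
  finally show ?thesis .
qed

lemma distinguishing_advantage_le:
  fixes out :: "nat \<Rightarrow> bool" and p :: real and step init l
  assumes t: "t \<ge> 2" and n: "n > 0" and p: "1 / real t \<le> p" "p \<le> 1"
    and st: "init < 2 ^ s" "\<And>j i st x. step j i st x < 2 ^ s"
  defines "acc \<equiv> \<lambda>X. out (state_at step init t X (l * t))"
  shows "pmf (map_pmf acc (planted_stream n t p)) True - pmf (map_pmf acc (uniform_stream n t)) True
    \<le> 1 / 6 + 108 * exp 2 * (real l * p\<^sup>2 * real s * real t * log 2 (real t))"
proof -
  let ?W = "needle_positions t p"
  let ?\<Omega> = "all_streams n t"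
  define a where "a = pmf (map_pmf acc (uniform_stream n t)) True"
  define b where "b = (\<lambda>S x. pmf (map_pmf (\<lambda>X. acc (plant S x X)) (uniform_stream n t)) True)"
  define e where "e = (\<lambda>S. (\<Sum>x<n. 1 - bhatt ?\<Omega> acc (\<lambda>X. acc (plant S x X))) / real n)"
  have ne: "?\<Omega> \<noteq> {}" using n by (metis card.empty card_all_streams less_numeral_extra(3) zero_less_power)
  have int: "integrable (measure_pmf ?W) f" for f :: "nat set \<Rightarrow> real"
    by (rule integrable_measure_pmf_finite[OF finite_set_needle_positions])
  have "map_pmf acc (planted_stream n t p) = bind_pmf ?W (\<lambda>S. bind_pmf (pmf_of_set {0..<n})
      (\<lambda>x. map_pmf (\<lambda>X. acc (plant S x X)) (uniform_stream n t)))"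
    unfolding planted_stream_eq[OF n] by (simp add: map_bind_pmf map_pmf_comp)
  then have "pmf (map_pmf acc (planted_stream n t p)) True
     = measure_pmf.expectation ?W (\<lambda>S. (\<Sum>x<n. b S x) / real n)"
    using n by (simp add: pmf_bind integral_pmf_of_set b_def lessThan_atLeast0)
  also have "\<dots> \<le> measure_pmf.expectation ?W (\<lambda>S. a + 1 / 6 + 12 * e S)"
  proof (rule integral_mono[OF int int])
    fix S
    have "b S x \<le> a + 1 / 6 + 12 * (1 - bhatt ?\<Omega> acc (\<lambda>X. acc (plant S x X)))" for x
    proof -
      have "(b S x - a)\<^sup>2 \<le> 8 * (1 - bhatt ?\<Omega> acc (\<lambda>X. acc (plant S x X)))"
        unfolding a_def b_def pmf_accept_uniform[OF n] by (rule acceptance_gap_le_bhatt[OF finite_all_streams ne])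
      \<comment> \<open>Tangent to the square at \<open>1 / 3\<close>. It makes the gap linear in
        the loss, so that the expectation over \<open>S\<close> and \<open>x\<close> can be taken
        directly; the constant \<open>1 / 6\<close> stays below the advantage \<open>1 / 3\<close>
        that success probability \<open>2 / 3\<close> demands.\<close>
      moreover have "b S x - a \<le> 1 / 6 + 3 / 2 * (b S x - a)\<^sup>2"
        using zero_le_power2[of "b S x - a - 1 / 3"] by (simp add: power2_eq_square algebra_simps)
      ultimately show ?thesis by linarith
    qed
    then have "(\<Sum>x<n. b S x) \<le> (\<Sum>x<n. a + 1 / 6 + 12 * (1 - bhatt ?\<Omega> acc (\<lambda>X. acc (plant S x X))))"
      by (rule sum_mono)
    also have "\<dots> = real n * (a + 1 / 6 + 12 * e S)"
      using n by (simp only: sum.distrib sum_distrib_left[symmetric] e_def) (simp add: algebra_simps)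
    finally show "(\<Sum>x<n. b S x) / real n \<le> a + 1 / 6 + 12 * e S" using n by (simp add: field_simps)
  qed
  also have "\<dots> = a + 1 / 6 + 12 * measure_pmf.expectation ?W e"
    by (subst Bochner_Integration.integral_add[OF int int]) simp
  also have "\<dots> \<le> a + 1 / 6 + 12 * (9 * exp 2 * (real l * p\<^sup>2 * real s * real t * log 2 (real t)))"
    unfolding e_def acc_def
    by (intro add_left_mono mult_left_mono expected_acceptance_loss_le t n p st) simp
  finally show ?thesis unfolding a_def by simp
qed

lemma success_prob_eq:
  "success_prob R step init out l n t p = measure_pmf.expectation R (\<lambda>r.
     1 / 2 + (pmf (map_pmf (\<lambda>X. out r (stream_run (step r) (init r) l t X)) (planted_stream n t p)) True
       - pmf (map_pmf (\<lambda>X. out r (stream_run (step r) (init r) l t X)) (uniform_stream n t)) True) / 2)"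
proof -
  let ?acc = "\<lambda>r X. out r (stream_run (step r) (init r) l t X)"
  have neg: "pmf (map_pmf (\<lambda>X. \<not> Q X) D) True = 1 - pmf (map_pmf Q D) True" for Q and D :: "(nat \<Rightarrow> nat) pmf"
  proof -
    have "pmf (map_pmf (\<lambda>X. \<not> Q X) D) True = measure_pmf.prob D (UNIV - Q -` {True})"
      unfolding pmf_map by (rule arg_cong2[where f = measure]) auto
    also have "\<dots> = 1 - measure_pmf.prob D (Q -` {True})" by (subst measure_pmf.prob_compl[symmetric]) simp_all
    finally show ?thesis by (simp add: pmf_map)
  qed
  have "success_prob R step init out l n t p = pmf (bind_pmf R (\<lambda>r. bind_pmf (bernoulli_pmf (1 / 2)) (\<lambda>b.
      map_pmf (\<lambda>X. ?acc r X = b) (if b then planted_stream n t p else uniform_stream n t)))) True"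
    unfolding success_prob_def map_pmf_def by (subst bind_commute_pmf) (rule refl)
  also have "\<dots> = measure_pmf.expectation R (\<lambda>r. 1 / 2 + (pmf (map_pmf (?acc r) (planted_stream n t p)) True
       - pmf (map_pmf (?acc r) (uniform_stream n t)) True) / 2)"
    by (subst pmf_bind, intro Bochner_Integration.integral_cong refl)
       (simp add: pmf_bind neg field_simps)
  finally show ?thesis .
qed

theorem mainTheorem1:
  shows "\<exists>C::real. \<exists>c::real. C > 0 \<and> c > 0 \<and>
    (\<forall>(n::nat) (t::nat) (p::real) (l::nat) (s::nat) (R::nat pmf)
       (step::nat \<Rightarrow> nat \<Rightarrow> nat \<Rightarrow> nat \<Rightarrow> nat \<Rightarrow> nat) (init::nat \<Rightarrow> nat)
       (out::nat \<Rightarrow> nat \<Rightarrow> bool).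
       n \<ge> 2 \<longrightarrow> t \<ge> 2 \<longrightarrow> 1 / real t \<le> p \<longrightarrow> p \<le> 1 \<longrightarrow>
       real n \<ge> C * (real t)^2 \<longrightarrow>
       streaming_alg_mem s step init \<longrightarrow>
       success_prob R step init out l n t p \<ge> 2/3 \<longrightarrow>
       real l * p^2 * real s * real t * log 2 (real t) \<ge> c)"
proof (rule exI[of _ 1], rule exI[of _ "1 / (648 * exp 2)"], intro conjI allI impI)
  fix n t :: nat and p :: real and l s :: nat and R :: "nat pmf"
    and step :: "nat \<Rightarrow> nat \<Rightarrow> nat \<Rightarrow> nat \<Rightarrow> nat \<Rightarrow> nat" and init :: "nat \<Rightarrow> nat" and out :: "nat \<Rightarrow> nat \<Rightarrow> bool"
  assume n: "2 \<le> n" and t: "2 \<le> t" and p: "1 / real t \<le> p" "p \<le> 1"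
    and mem: "streaming_alg_mem s step init" and succ: "2 / 3 \<le> success_prob R step init out l n t p"
  define G where "G = real l * p\<^sup>2 * real s * real t * log 2 (real t)"
  define f where "f = (\<lambda>r. 1 / 2 + (pmf (map_pmf (\<lambda>X. out r (stream_run (step r) (init r) l t X)) (planted_stream n t p)) True
       - pmf (map_pmf (\<lambda>X. out r (stream_run (step r) (init r) l t X)) (uniform_stream n t)) True) / 2)"
  have "f r \<le> 7 / 12 + 54 * exp 2 * G" for r
  proof -
    have "init r < 2 ^ s" "step r j i st x < 2 ^ s" for j i st x
      using mem by (simp_all add: streaming_alg_mem_def)
    then have "pmf (map_pmf (\<lambda>X. out r (stream_run (step r) (init r) l t X)) (planted_stream n t p)) True
        - pmf (map_pmf (\<lambda>X. out r (stream_run (step r) (init r) l t X)) (uniform_stream n t)) True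
        \<le> 1 / 6 + 108 * exp 2 * G"
      unfolding stream_run_eq_state_at G_def using n by (intro distinguishing_advantage_le t p) auto
    moreover have "1 / 2 + x / 2 \<le> 7 / 12 + 54 * exp 2 * G" if "x \<le> 1 / 6 + 108 * exp 2 * G" for x :: real
      using that by (simp add: field_simps)
    ultimately show ?thesis unfolding f_def by blast
  qed
  \<comment> \<open>The seed may have infinite support, so integrability comes from
    boundedness.\<close>
  moreover have "integrable (measure_pmf R) f"
  proof (rule measure_pmf.integrable_const_bound[where B = 1])
    have "\<bar>1 / 2 + (x - y) / 2\<bar> \<le> 1" if "0 \<le> x" "x \<le> 1" "0 \<le> y" "y \<le> 1" for x y :: real
      using that by (auto simp: abs_le_iff field_simps)
    then show "AE r in measure_pmf R. norm (f r) \<le> 1"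
      by (simp add: f_def pmf_le_1)
  qed simp
  ultimately have "measure_pmf.expectation R f \<le> 7 / 12 + 54 * exp 2 * G"
    by (intro measure_pmf.integral_le_const) auto
  \<comment> \<open>The bound holds for every seed, hence on average. The gap
    \<open>2 / 3 - 7 / 12 = 1 / 12\<close> divided by \<open>54 * exp 2\<close> is the constant
    \<open>c\<close>.\<close>
  with succ have "2 / 3 \<le> 7 / 12 + 54 * exp 2 * G"
    unfolding success_prob_eq f_def by linarith
  then show "1 / (648 * exp 2) \<le> G" by (simp add: field_simps)
qed auto

end
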